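(* Let $\delta>0$ be a constant. In the asymmetric streaming model, given an offline string $\bar{s}$ and an online string $s$, both of length $n$, there exists a single-pass deterministic streaming algorithm that computes an $O(2^{1/\delta})$-approximation of the edit distance $\mathrm{ed}(s,\bar{s})$ (i.e. a value $D$ with $\mathrm{ed}(s,\bar{s})\le D\le O(2^{1/\delta})\cdot \mathrm{ed}(s,\bar{s})$) using $\tilde{O}(n^{\delta}/\delta)$ memory.
   Context: The edit distance $\mathrm{ed}(x,y)$ between two strings is the minimum number of character insertions, deletions and substitutions needed to transform one into the other. In the asymmetric streaming model, the algorithm has random (query) access to the characters of the offline string $\bar{s}$, while the characters of the online string $s$ arrive one by one as a stream; memory is the working space used by the algorithm. $\tilde{O}(\cdot)$ hides polylogarithmic factors in $n$. *)

theory Defs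
  imports Complex_Main "HOL-Library.Discrete_Functions"
begin

inductive edit_step :: "'a list \<Rightarrow> 'a list \<Rightarrow> bool" where
  insertion: "edit_step (u @ v) (u @ [a] @ v)"
| deletion: "edit_step (u @ [a] @ v) (u @ v)"
| substitution: "edit_step (u @ [a] @ v) (u @ [b] @ v)"

definition ed :: "'a list \<Rightarrow> 'a list \<Rightarrow> nat" where
  "ed x y = (LEAST k. (edit_step ^^ k) x y)"

text \<open>
  Asymmetric streaming algorithms are programs of a small imperative language. A program is a
  fixed finite text, independent of the input and of its length. It owns finitely many number
  registers, holding natural numbers of arbitrary size, and finitely many character registers.
  Characters can only be loaded from one of the two strings and tested for equality, so one
  program serves every alphabet.
\<close>

datatype aexp =
    Num nat
  | Reg nat
  | Add aexp aexp
  | Sub aexp aexp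
  | Mul aexp aexp
  | Div aexp aexp
  | Mod aexp aexp

datatype bexp =
    Less aexp aexp
  | SameChar nat nat
  | Neg bexp
  | Conj bexp bexp

datatype com =
    Skip
  | Assign nat aexp
  | Query nat aexp
  | Read nat
  | Seq com com
  | Cond bexp com com
  | Loop bexp com

record 'a state =
  reg :: "nat \<Rightarrow> nat"
  chr :: "nat \<Rightarrow> 'a option"
  stream :: "'a list"

fun aval :: "aexp \<Rightarrow> 'a state \<Rightarrow> nat" where
  "aval (Num k) st = k"
| "aval (Reg r) st = reg st r"
| "aval (Add e f) st = aval e st + aval f st"
| "aval (Sub e f) st = aval e st - aval f st"
| "aval (Mul e f) st = aval e st * aval f st"
| "aval (Div e f) st = aval e st div aval f st"
| "aval (Mod e f) st = aval e st mod aval f st"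

fun bval :: "bexp \<Rightarrow> 'a state \<Rightarrow> bool" where
  "bval (Less e f) st = (aval e st < aval f st)"
| "bval (SameChar c d) st = (chr st c = chr st d)"
| "bval (Neg b) st = (\<not> bval b st)"
| "bval (Conj b b') st = (bval b st \<and> bval b' st)"

text \<open>The length of the binary representation; the number 0 occupies one bit.\<close>

definition bits :: "nat \<Rightarrow> nat" where
  "bits k = Suc (floor_log k)"

text \<open>
  The temporary space for evaluating an expression: the values of all its subexpressions are
  charged, so that no intermediate result is free.
\<close>

fun aspace :: "aexp \<Rightarrow> 'a state \<Rightarrow> nat" where
  "aspace (Num k) st = bits k"
| "aspace (Reg r) st = bits (reg st r)"
| "aspace (Add e f) st = aspace e st + aspace f st + bits (aval (Add e f) st)"
| "aspace (Sub e f) st = aspace e st + aspace f st + bits (aval (Sub e f) st)"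
| "aspace (Mul e f) st = aspace e st + aspace f st + bits (aval (Mul e f) st)"
| "aspace (Div e f) st = aspace e st + aspace f st + bits (aval (Div e f) st)"
| "aspace (Mod e f) st = aspace e st + aspace f st + bits (aval (Mod e f) st)"

fun bspace :: "bexp \<Rightarrow> 'a state \<Rightarrow> nat" where
  "bspace (Less e f) st = aspace e st + aspace f st + 1"
| "bspace (SameChar c d) st = 1"
| "bspace (Neg b) st = bspace b st + 1"
| "bspace (Conj b b') st = bspace b st + bspace b' st + 1"

fun aregs :: "aexp \<Rightarrow> nat set" where
  "aregs (Num k) = {}"
| "aregs (Reg r) = {r}"
| "aregs (Add e f) = aregs e \<union> aregs f"
| "aregs (Sub e f) = aregs e \<union> aregs f"
| "aregs (Mul e f) = aregs e \<union> aregs f"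
| "aregs (Div e f) = aregs e \<union> aregs f"
| "aregs (Mod e f) = aregs e \<union> aregs f"

fun bregs :: "bexp \<Rightarrow> nat set" where
  "bregs (Less e f) = aregs e \<union> aregs f"
| "bregs (SameChar c d) = {}"
| "bregs (Neg b) = bregs b"
| "bregs (Conj b b') = bregs b \<union> bregs b'"

fun bchrs :: "bexp \<Rightarrow> nat set" where
  "bchrs (Less e f) = {}"
| "bchrs (SameChar c d) = {c, d}"
| "bchrs (Neg b) = bchrs b"
| "bchrs (Conj b b') = bchrs b \<union> bchrs b'"

fun regs :: "com \<Rightarrow> nat set" where
  "regs Skip = {}"
| "regs (Assign r e) = insert r (aregs e)"
| "regs (Query c e) = aregs e"
| "regs (Read c) = {}"
| "regs (Seq p q) = regs p \<union> regs q"
| "regs (Cond b p q) = bregs b \<union> regs p \<union> regs q"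
| "regs (Loop b p) = bregs b \<union> regs p"

fun chrs :: "com \<Rightarrow> nat set" where
  "chrs Skip = {}"
| "chrs (Assign r e) = {}"
| "chrs (Query c e) = {c}"
| "chrs (Read c) = {c}"
| "chrs (Seq p q) = chrs p \<union> chrs q"
| "chrs (Cond b p q) = bchrs b \<union> chrs p \<union> chrs q"
| "chrs (Loop b p) = bchrs b \<union> chrs p"

text \<open>
  The memory occupied by the registers of the program \<open>P\<close>: number registers are charged by their
  bits, a character occupies one cell. Register 0 is always charged, as it carries the input
  length and the output. Neither string is charged.
\<close>

definition mem :: "com \<Rightarrow> 'a state \<Rightarrow> nat" where
  "mem P st = (\<Sum>r\<in>insert 0 (regs P). bits (reg st r)) + card (chrs P)"

text \<open>
  \<open>run P off p st st' m\<close>: as a part of the program \<open>P\<close>, the command \<open>p\<close> started in \<open>st\<close> terminates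
  in \<open>st'\<close>, with \<open>m\<close> the maximal memory in use at any time. The offline string \<open>off\<close> is accessible
  at any position through \<open>Query\<close>. \<open>Read\<close> consumes the next character of the online string, which
  cannot be accessed in any other way, so that every execution makes a single pass.
  Reading past the end of either string clears the character register.
\<close>

inductive run ::
    "com \<Rightarrow> 'a list \<Rightarrow> com \<Rightarrow> 'a state \<Rightarrow> 'a state \<Rightarrow> nat \<Rightarrow> bool"
  for P :: com and off :: "'a list" where
  Skip: "run P off Skip st st (mem P st)"
| Assign: "st' = st\<lparr>reg := (reg st)(r := aval e st)\<rparr> \<Longrightarrow>
    run P off (Assign r e) st st' (max (mem P st + aspace e st) (mem P st'))"
| Query: "i = aval e st \<Longrightarrow>
    st' = st\<lparr>chr := (chr st)(c := (if i < length off then Some (off ! i) else None))\<rparr> \<Longrightarrow>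
    run P off (Query c e) st st' (max (mem P st + aspace e st) (mem P st'))"
| Read: "stream st = a # rest \<Longrightarrow>
    st' = st\<lparr>chr := (chr st)(c := Some a), stream := rest\<rparr> \<Longrightarrow>
    run P off (Read c) st st' (max (mem P st) (mem P st'))"
| Read_end: "stream st = [] \<Longrightarrow>
    st' = st\<lparr>chr := (chr st)(c := None)\<rparr> \<Longrightarrow>
    run P off (Read c) st st' (max (mem P st) (mem P st'))"
| Seq: "run P off p st st' m \<Longrightarrow> run P off q st' st'' m' \<Longrightarrow>
    run P off (Seq p q) st st'' (max m m')"
| Cond_true: "bval b st \<Longrightarrow> run P off p st st' m \<Longrightarrow>
    run P off (Cond b p q) st st' (max (mem P st + bspace b st) m)"
| Cond_false: "\<not> bval b st \<Longrightarrow> run P off q st st' m \<Longrightarrow>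
    run P off (Cond b p q) st st' (max (mem P st + bspace b st) m)"
| Loop_exit: "\<not> bval b st \<Longrightarrow>
    run P off (Loop b p) st st (mem P st + bspace b st)"
| Loop_step: "bval b st \<Longrightarrow> run P off p st st' m \<Longrightarrow> run P off (Loop b p) st' st'' m' \<Longrightarrow>
    run P off (Loop b p) st st'' (max (mem P st + bspace b st) (max m m'))"

lemma run_deterministic:
  "run P off p st st' m \<Longrightarrow> run P off p st st'' m' \<Longrightarrow> st'' = st' \<and> m' = m"
proof (induction arbitrary: st'' m' rule: run.induct)
  case (Seq p st st' m q st2 m2)
  from Seq.prems show ?case
    by (cases rule: run.cases) (use Seq.IH in blast)+
next
  case (Cond_true b st p st' m q)
  from Cond_true.prems Cond_true.hyps show ?case
    by (cases rule: run.cases) (use Cond_true.IH in blast)+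
next
  case (Cond_false b st q st' m p)
  from Cond_false.prems Cond_false.hyps show ?case
    by (cases rule: run.cases) (use Cond_false.IH in blast)+
next
  case (Loop_step b st p st' m st2 m2)
  from Loop_step.prems Loop_step.hyps show ?case
    by (cases rule: run.cases) (use Loop_step.IH in blast)+
qed (erule run.cases; simp)+

definition initial_state :: "nat \<Rightarrow> 'a list \<Rightarrow> 'a state" where
  "initial_state n s = \<lparr>reg = (\<lambda>_. 0)(0 := n), chr = (\<lambda>_. None), stream = s\<rparr>"

text \<open>
  On offline string \<open>off\<close> and online string \<open>s\<close>, the program \<open>P\<close> halts with output \<open>D\<close> after using
  \<open>m\<close> units of memory.
\<close>

definition computes :: "com \<Rightarrow> 'a list \<Rightarrow> 'a list \<Rightarrow> nat \<Rightarrow> nat \<Rightarrow> bool" where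
  "computes P off s D m \<longleftrightarrow>
     (\<exists>st. run P off P (initial_state (length off) s) st m \<and> reg st 0 = D)"

end

theory Submission
  imports Defs "HOL-Library.Nat_Bijection"
begin

text \<open>
  Let \<open>k = \<lceil>1/\<delta>\<rceil>\<close> and let \<open>b\<close> be the least number with \<open>n \<le> b\<^sup>k\<close>. A block of \<open>b\<^sup>j\<close> consecutive online
  characters is replaced by a substring of the offline string \<open>y\<close>, stored as a pair of positions:
  \<open>b\<close> consecutive blocks of level \<open>j\<close> have been replaced by substrings \<open>w\<^sub>1, \<dots>, w\<^sub>b\<close>, and their union
  is replaced by a substring of \<open>y\<close> closest to \<open>w\<^sub>1 \<dots> w\<^sub>b\<close>. The output is the sum of all
  distances incurred, plus the distance of the last substring to \<open>y\<close>. If the total cost for every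
  block of level \<open>j\<close> is at most \<open>C\<close> times its distance to any substring of \<open>y\<close>, then the triangle
  inequality gives the factor \<open>2 C + 1\<close> on level \<open>j + 1\<close>, hence a factor \<open>O(2\<^sup>k)\<close> in the end. At
  any time at most \<open>b\<close> pairs of positions are stored on each of the \<open>k\<close> levels.

  The offline problem, to compute the distance of \<open>w\<^sub>1 \<dots> w\<^sub>b\<close> and a substring of \<open>y\<close>, is solved
  exactly in the same space. All ways to cut the substring into \<open>b\<close> parts are enumerated by one
  number with \<open>b\<close> digits in base \<open>n + 1\<close>; the distance of the i-th part to \<open>w\<^sub>i\<close> is computed by
  cutting \<open>w\<^sub>i\<close> into \<open>b\<close> equal pieces and recursing. Pieces of length 1 are reached at depth \<open>k\<close>,
  so the recursion can be unfolded into the text of the program.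

  All registers stay below \<open>U = (n + 2)\<^bsup>2b + 6\<^esup>\<close>, and there are \<open>O(k)\<close> of them. This bounds the
  memory by \<open>O(k b log n)\<close>.
\<close>

section \<open>Edit distance\<close>

lemma edit_step_sym: "edit_step x y \<Longrightarrow> edit_step y x"
  by (induction rule: edit_step.induct) (rule edit_step.intros)+

lemma edits_sym: "(edit_step ^^ k) x y \<Longrightarrow> (edit_step ^^ k) y x"
proof (induction k arbitrary: y)
  case (Suc k)
  then obtain z where z: "(edit_step ^^ k) x z" "edit_step z y"
    by auto
  show ?case
    by (rule relpowp_Suc_I2[OF edit_step_sym[OF z(2)] Suc.IH[OF z(1)]])
qed auto

lemma edit_step_context: "edit_step x y \<Longrightarrow> edit_step (u @ x @ v) (u @ y @ v)"
proof (induction rule: edit_step.induct)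
  case (insertion p q a)
  show ?case using edit_step.insertion[of "u @ p" "q @ v" a] by simp
next
  case (deletion p a q)
  show ?case using edit_step.deletion[of "u @ p" a "q @ v"] by simp
next
  case (substitution p a q c)
  show ?case using edit_step.substitution[of "u @ p" a "q @ v" c] by simp
qed

lemma edits_context: "(edit_step ^^ k) x y \<Longrightarrow> (edit_step ^^ k) (u @ x @ v) (u @ y @ v)"
proof (induction k arbitrary: y)
  case (Suc k)
  then obtain z where z: "(edit_step ^^ k) x z" "edit_step z y"
    by auto
  show ?case
    by (rule relpowp_Suc_I[OF Suc.IH[OF z(1)] edit_step_context[OF z(2)]])
qed auto

lemma edits_add:
  "(edit_step ^^ k) x y \<Longrightarrow> (edit_step ^^ l) y z \<Longrightarrow> (edit_step ^^ (k + l)) x z"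
  by (auto simp: relpowp_add)

lemma edits_append:
  assumes "(edit_step ^^ k) x y" "(edit_step ^^ l) u v"
  shows "(edit_step ^^ (k + l)) (x @ u) (y @ v)"
  using edits_add[OF edits_context[OF assms(1), of "[]" u, simplified] edits_context[OF assms(2), of y "[]", simplified]]
  by simp

lemma edits_from_Nil: "(edit_step ^^ length y) [] y"
proof (induction y)
  case (Cons a y)
  have "edit_step y (a # y)"
    using edit_step.insertion[of "[]" y a] by simp
  from relpowp_Suc_I[OF Cons this] show ?case by simp
qed auto

text \<open>Substitute position by position, then insert or delete the overhang. Besides the bound,
  this shows that the \<open>LEAST\<close> in \<open>ed\<close> ranges over a nonempty set and is
  attained.\<close>

lemma edits_le_max: "\<exists>k\<le>max (length x) (length y). (edit_step ^^ k) x y"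
proof (induction x arbitrary: y)
  case Nil
  show ?case using edits_from_Nil[of y] by auto
next
  case (Cons a x)
  show ?case
  proof (cases y)
    case Nil
    then show ?thesis
      using edits_sym[OF edits_from_Nil[of "a # x"]] by (intro exI[of _ "Suc (length x)"]) auto
  next
    case (Cons c z)
    obtain k where k: "k \<le> max (length x) (length z)" "(edit_step ^^ k) x z"
      using Cons.IH by blast
    have "(edit_step ^^ 1) [a] [c]"
      using edit_step.substitution[of "[]" a "[]" c] by (simp add: eq_OO)
    from edits_append[OF this k(2)] show ?thesis
      using k(1) Cons by (intro exI[of _ "Suc k"]) auto
  qed
qed

lemma ed_le: "(edit_step ^^ k) x y \<Longrightarrow> ed x y \<le> k"
  unfolding ed_def by (rule Least_le)

lemma ed_edits: "(edit_step ^^ ed x y) x y"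
proof -
  from edits_le_max[of x y] obtain k where "(edit_step ^^ k) x y"
    by blast
  then show ?thesis
    unfolding ed_def by (rule LeastI)
qed

lemma ed_le_max: "ed x y \<le> max (length x) (length y)"
  using edits_le_max[of x y] ed_le le_trans by blast

lemma ed_sym: "ed x y = ed y x"
  by (intro antisym ed_le[OF edits_sym[OF ed_edits]])

lemma ed_triangle: "ed x z \<le> ed x y + ed y z"
  by (rule ed_le[OF edits_add[OF ed_edits ed_edits]])

lemma ed_append: "ed (x @ u) (y @ v) \<le> ed x y + ed u v"
  by (rule ed_le[OF edits_append[OF ed_edits ed_edits]])

lemma ed_refl [simp]: "ed x x = 0"
  using ed_le[of 0 x x] by simp

lemma ed_0D: "ed x y = 0 \<Longrightarrow> x = y"
  using ed_edits[of x y] by simp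

section \<open>Cutting edit sequences at a concatenation\<close>

lemma append_eq_append_ConsE:
  assumes "x @ y = u @ [a] @ v"
  obtains w where "x = u @ [a] @ w" "v = w @ y" | w where "u = x @ w" "y = w @ [a] @ v"
proof -
  from assms obtain w where "x = u @ w \<and> w @ y = a # v \<or> x @ w = u \<and> y = w @ a # v"
    by (auto simp: append_eq_append_conv2)
  then show thesis
    using that by (cases w) auto
qed

text \<open>A single edit touches one letter or one gap, hence only one of the two factors; an
  insertion at the border can be attributed to either.\<close>

lemma edit_step_append_split:
  assumes "edit_step (x @ y) z"
  shows "\<exists>x' y'. z = x' @ y' \<and> (edit_step x x' \<and> y' = y \<or> x' = x \<and> edit_step y y')"
  using assms
proof (cases rule: edit_step.cases)
  case (insertion u v a)
  then consider w where "x = u @ w" "v = w @ y" | w where "u = x @ w" "y = w @ v"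
    by (auto simp: append_eq_append_conv2)
  then show ?thesis
  proof cases
    case (1 w)
    then show ?thesis
      using insertion edit_step.insertion[of u w a]
      by (intro exI[of _ "u @ [a] @ w"] exI[of _ y]) auto
  next
    case (2 w)
    then show ?thesis
      using insertion edit_step.insertion[of w v a]
      by (intro exI[of _ x] exI[of _ "w @ [a] @ v"]) auto
  qed
next
  case (deletion u a v)
  from this(1) show ?thesis
  proof (cases rule: append_eq_append_ConsE)
    case (1 w)
    then show ?thesis
      using deletion edit_step.deletion[of u a w]
      by (intro exI[of _ "u @ w"] exI[of _ y]) auto
  next
    case (2 w)
    then show ?thesis
      using deletion edit_step.deletion[of w a v]
      by (intro exI[of _ x] exI[of _ "w @ v"]) auto
  qed
next
  case (substitution u a v c)
  from this(1) show ?thesis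
  proof (cases rule: append_eq_append_ConsE)
    case (1 w)
    then show ?thesis
      using substitution edit_step.substitution[of u a w c]
      by (intro exI[of _ "u @ [c] @ w"] exI[of _ y]) auto
  next
    case (2 w)
    then show ?thesis
      using substitution edit_step.substitution[of w a v c]
      by (intro exI[of _ x] exI[of _ "w @ [c] @ v"]) auto
  qed
qed

lemma edits_append_split:
  assumes "(edit_step ^^ k) (x @ y) z"
  shows "\<exists>x' y' i j. z = x' @ y' \<and> i + j = k \<and> (edit_step ^^ i) x x' \<and> (edit_step ^^ j) y y'"
  using assms
proof (induction k arbitrary: z)
  case 0
  then show ?case by auto
next
  case (Suc k)
  then obtain w where w: "(edit_step ^^ k) (x @ y) w" "edit_step w z"
    by auto
  from Suc.IH[OF w(1)] obtain x' y' i j where ij: "w = x' @ y'" "i + j = k"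
      "(edit_step ^^ i) x x'" "(edit_step ^^ j) y y'"
    by blast
  obtain x2 y2 where z: "z = x2 @ y2"
      "edit_step x' x2 \<and> y2 = y' \<or> x2 = x' \<and> edit_step y' y2"
    using edit_step_append_split[OF w(2)[unfolded ij(1)]] by blast
  from z(2) show ?case
  proof
    assume *: "edit_step x' x2 \<and> y2 = y'"
    then have "(edit_step ^^ Suc i) x x2"
      using relpowp_Suc_I[OF ij(3)] by blast
    moreover have "Suc i + j = Suc k"
      using ij(2) by simp
    ultimately show ?thesis
      using * ij(4) z(1) by blast
  next
    assume *: "x2 = x' \<and> edit_step y' y2"
    then have "(edit_step ^^ Suc j) y y2"
      using relpowp_Suc_I[OF ij(4)] by blast
    moreover have "i + Suc j = Suc k"
      using ij(2) by simp
    ultimately show ?thesis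
      using * ij(3) z(1) by blast
  qed
qed

text \<open>Together with \<open>ed_append\<close>, this makes \<open>ed (x @ y) z\<close> the
  minimum over all cuts of \<open>z\<close>. Both the exact enumeration of cuts and the blockwise
  approximation rest on it.\<close>

lemma ed_append_split:
  obtains z1 z2 where "z = z1 @ z2" "ed x z1 + ed y z2 \<le> ed (x @ y) z"
proof -
  obtain z1 z2 i j where "z = z1 @ z2" "i + j = ed (x @ y) z"
      "(edit_step ^^ i) x z1" "(edit_step ^^ j) y z2"
    using edits_append_split[OF ed_edits[of "x @ y" z]] by blast
  then show thesis
    using that ed_le[of i x z1] ed_le[of j y z2] by simp
qed

text \<open>One edit creates at most one letter with property \<open>Q\<close>. Counting all letters
  bounds \<open>ed\<close> by the difference of lengths; counting the letters other than
  \<open>a\<close> gives the lower bound for a singleton.\<close>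

lemma edits_filter_length:
  "(edit_step ^^ k) x y \<Longrightarrow> length (filter Q y) \<le> length (filter Q x) + k"
proof (induction k arbitrary: y)
  case (Suc k)
  then obtain z where z: "(edit_step ^^ k) x z" "edit_step z y"
    by auto
  from z(2) have "length (filter Q y) \<le> Suc (length (filter Q z))"
    by (cases rule: edit_step.cases) auto
  with Suc.IH[OF z(1)] show ?case by simp
qed auto

lemma ed_filter_length: "length (filter Q y) \<le> length (filter Q x) + ed x y"
  by (rule edits_filter_length[OF ed_edits])

lemma ed_length: "length y \<le> length x + ed x y"
  using ed_filter_length[of "\<lambda>_. True"] by simp

lemma ed_Nil: "ed [] y = length y"
  using ed_length[of y "[]"] ed_le_max[of "[]" y] by simp

text \<open>The base case of the distance recursion. If \<open>a\<close> occurs, it is kept and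
  everything around it is inserted; otherwise every letter of \<open>y\<close> has to be created.
  The \<open>max 1\<close> accounts for empty \<open>y\<close>, where \<open>a\<close> must be
  deleted.\<close>

lemma ed_singleton: "ed [a] y = (if a \<in> set y then length y - 1 else max 1 (length y))"
proof (cases "a \<in> set y")
  case True
  then obtain u v where y: "y = u @ [a] @ v"
    by (metis append_Cons append_Nil split_list)
  have "ed [a] y \<le> ed [] u + (ed [a] [a] + ed [] v)"
    using ed_append[of "[]" "[a]" u "[a] @ v"] ed_append[of "[a]" "[]" "[a]" v] y by simp
  then show ?thesis
    using True y ed_length[of y "[a]"] by (simp add: ed_Nil)
next
  case False
  then have "filter (\<lambda>c. c \<noteq> a) y = y"
    by (auto simp: filter_id_conv)
  then have "length y \<le> ed [a] y"
    using ed_filter_length[of "\<lambda>c. c \<noteq> a" y "[a]"] by simp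
  moreover have "1 \<le> ed [a] y"
    using False ed_0D[of "[a]" y] by (cases "ed [a] y") auto
  ultimately show ?thesis
    using False ed_le_max[of "[a]" y] by simp
qed

section \<open>Total correctness with bounded space\<close>

fun asize :: "aexp \<Rightarrow> nat" where
  "asize (Num k) = 1"
| "asize (Reg r) = 1"
| "asize (Add e f) = asize e + asize f + 1"
| "asize (Sub e f) = asize e + asize f + 1"
| "asize (Mul e f) = asize e + asize f + 1"
| "asize (Div e f) = asize e + asize f + 1"
| "asize (Mod e f) = asize e + asize f + 1"

fun bsize :: "bexp \<Rightarrow> nat" where
  "bsize (Less e f) = asize e + asize f + 1"
| "bsize (SameChar c d) = 1"
| "bsize (Neg b) = bsize b + 1"
| "bsize (Conj b b') = bsize b + bsize b' + 1"

text \<open>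
  Among the arithmetic operations only sums and products can exceed their arguments (in
  particular \<open>x div 0 = 0\<close> and \<open>x mod 0 = x\<close>), so these are the only ones to be checked.
\<close>

fun asafe :: "nat \<Rightarrow> aexp \<Rightarrow> 'a state \<Rightarrow> bool" where
  "asafe U (Num k) st = (k < U)"
| "asafe U (Reg r) st = True"
| "asafe U (Add e f) st = (asafe U e st \<and> asafe U f st \<and> aval e st + aval f st < U)"
| "asafe U (Sub e f) st = (asafe U e st \<and> asafe U f st)"
| "asafe U (Mul e f) st = (asafe U e st \<and> asafe U f st \<and> aval e st * aval f st < U)"
| "asafe U (Div e f) st = (asafe U e st \<and> asafe U f st)"
| "asafe U (Mod e f) st = (asafe U e st \<and> asafe U f st)"

fun bsafe :: "nat \<Rightarrow> bexp \<Rightarrow> 'a state \<Rightarrow> bool" where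
  "bsafe U (Less e f) st = (asafe U e st \<and> asafe U f st)"
| "bsafe U (SameChar c d) st = True"
| "bsafe U (Neg b) st = bsafe U b st"
| "bsafe U (Conj b b') st = (bsafe U b st \<and> bsafe U b' st)"

fun writes :: "com \<Rightarrow> nat set" where
  "writes Skip = {}"
| "writes (Assign r e) = {r}"
| "writes (Query c e) = {}"
| "writes (Read c) = {}"
| "writes (Seq p q) = writes p \<union> writes q"
| "writes (Cond b p q) = writes p \<union> writes q"
| "writes (Loop b p) = writes p"

fun reads :: "com \<Rightarrow> bool" where
  "reads Skip = False"
| "reads (Assign r e) = False"
| "reads (Query c e) = False"
| "reads (Read c) = True"
| "reads (Seq p q) = (reads p \<or> reads q)"
| "reads (Cond b p q) = (reads p \<or> reads q)"
| "reads (Loop b p) = reads p"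

definition bounded :: "nat \<Rightarrow> 'a state \<Rightarrow> bool" where
  "bounded U st \<longleftrightarrow> (\<forall>r. reg st r < U)"

definition frame :: "com \<Rightarrow> 'a state \<Rightarrow> 'a state \<Rightarrow> bool" where
  "frame p st st' \<longleftrightarrow>
     (\<forall>r. r \<notin> writes p \<longrightarrow> reg st' r = reg st r) \<and> (\<not> reads p \<longrightarrow> stream st' = stream st)"

lemma run_frame: "run P off p st st' m \<Longrightarrow> frame p st st'"
  by (induction rule: run.induct) (auto simp: frame_def)

lemma finite_aregs [simp]: "finite (aregs e)"
  by (induction e) auto

lemma finite_bregs [simp]: "finite (bregs b)"
  by (induction b) auto

lemma finite_regs [simp]: "finite (regs p)"
  by (induction p) auto

lemma bits_mono: "k \<le> l \<Longrightarrow> bits k \<le> bits l"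
  unfolding bits_def using floor_log_mono by (simp add: monoD)

lemma bits_ge_1: "1 \<le> bits k"
  by (simp add: bits_def)

lemma aval_less: "bounded U st \<Longrightarrow> asafe U e st \<Longrightarrow> aval e st < U"
proof (induction e)
  case (Div e f)
  then show ?case
    using le_less_trans[OF div_le_dividend[of "aval e st" "aval f st"]] by simp
next
  case (Mod e f)
  then show ?case
    using le_less_trans[OF mod_less_eq_dividend[of "aval e st" "aval f st"]] by simp
qed (auto simp: bounded_def less_imp_diff_less)

lemma aspace_le: "bounded U st \<Longrightarrow> asafe U e st \<Longrightarrow> aspace e st \<le> asize e * bits U"
proof (induction e)
  case (Num k)
  then show ?case by (simp add: bits_mono)
next
  case (Reg r)
  then show ?case by (auto simp: bits_mono bounded_def less_imp_le)
next
  case (Add e f)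
  then show ?case
    using bits_mono[OF less_imp_le[OF aval_less[OF Add.prems]]] by (simp add: algebra_simps)
next
  case (Sub e f)
  then show ?case
    using bits_mono[OF less_imp_le[OF aval_less[OF Sub.prems]]] by (simp add: algebra_simps)
next
  case (Mul e f)
  then show ?case
    using bits_mono[OF less_imp_le[OF aval_less[OF Mul.prems]]] by (simp add: algebra_simps)
next
  case (Div e f)
  then show ?case
    using bits_mono[OF less_imp_le[OF aval_less[OF Div.prems]]] by (simp add: algebra_simps)
next
  case (Mod e f)
  then show ?case
    using bits_mono[OF less_imp_le[OF aval_less[OF Mod.prems]]] by (simp add: algebra_simps)
qed

lemma bspace_le: "bounded U st \<Longrightarrow> bsafe U b st \<Longrightarrow> bspace b st \<le> bsize b * bits U"
proof (induction b)
  case (Less e f)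
  then show ?case
    using aspace_le[of U st e] aspace_le[of U st f] bits_ge_1[of U]
    by (simp add: algebra_simps)
qed (use bits_ge_1[of U] in \<open>auto simp: algebra_simps\<close>)

lemma mem_le:
  assumes "bounded U st"
  shows "mem P st \<le> card (insert 0 (regs P)) * bits U + card (chrs P)"
  using sum_bounded_above[of "insert 0 (regs P)" "\<lambda>r. bits (reg st r)" "bits U"] assms
  by (auto simp: mem_def bounded_def bits_mono less_imp_le)

text \<open>The only form of loop in the programs below. The counter also serves as the loop index:
  a text position, an encoded cut, an encoded interval or a candidate root.\<close>

definition countdown :: "nat \<Rightarrow> com \<Rightarrow> com" where
  "countdown T p = Loop (Less (Num 0) (Reg T)) (Seq (Assign T (Sub (Reg T) (Num 1))) p)"

lemma countdown_simps [simp]: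
  "writes (countdown T p) = insert T (writes p)"
  "reads (countdown T p) = reads p"
  "regs (countdown T p) = insert T (regs p)"
  "chrs (countdown T p) = chrs p"
  by (auto simp: countdown_def)

text \<open>
  Expressions of size up to 20 may be evaluated on top of the registers; all expressions below
  are that small.
\<close>

locale space_bounded =
  fixes P :: com and off :: "'a list" and U K :: nat
  assumes space: "bounded U (st :: 'a state) \<Longrightarrow> mem P st + 20 * bits U \<le> K"
    and U_gt_1: "1 < U"
begin

lemma U_gt [simp]: "0 < U" "Suc 0 < U"
  using U_gt_1 by simp_all

text \<open>A weakest precondition for one start state. Boundedness by \<open>U\<close> is threaded
  through the judgement itself, so that postconditions need not mention it.\<close>

definition ok :: "com \<Rightarrow> 'a state \<Rightarrow> ('a state \<Rightarrow> bool) \<Rightarrow> bool" where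
  "ok p st Q \<longleftrightarrow>
     (bounded U st \<longrightarrow> (\<exists>st' m. run P off p st st' m \<and> m \<le> K \<and> bounded U st' \<and> Q st'))"

lemma okI:
  assumes "bounded U st \<Longrightarrow> run P off p st st' m" "bounded U st \<Longrightarrow> m \<le> K"
    "bounded U st \<Longrightarrow> bounded U st'" "bounded U st \<Longrightarrow> Q st'"
  shows "ok p st Q"
  unfolding ok_def using assms by blast

lemma okE:
  assumes "ok p st Q" "bounded U st"
  obtains st' m where "run P off p st st' m" "m \<le> K" "bounded U st'" "Q st'"
  using assms unfolding ok_def by blast

text \<open>Besides weakening, the rule supplies the frame of \<open>p\<close>. Specifications can
  thus be confined to the result registers; unchanged registers are recovered from
  \<open>writes\<close>.\<close>

lemma ok_consequence:
  assumes "ok p st Q" "\<And>st'. Q st' \<Longrightarrow> frame p st st' \<Longrightarrow> bounded U st' \<Longrightarrow> Q' st'"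
  shows "ok p st Q'"
  unfolding ok_def
proof
  assume "bounded U st"
  with assms(1) obtain st' m where *: "run P off p st st' m" "m \<le> K" "bounded U st'" "Q st'"
    by (rule okE)
  from assms(2)[OF *(4) run_frame[OF *(1)] *(3)] *
  show "\<exists>st' m. run P off p st st' m \<and> m \<le> K \<and> bounded U st' \<and> Q' st'"
    by blast
qed

lemma space_expr: "bounded U (st :: 'a state) \<Longrightarrow> x \<le> 20 * bits U \<Longrightarrow> mem P st + x \<le> K"
  using space[of st] by simp

lemma space_aexp:
  "bounded U (st :: 'a state) \<Longrightarrow> asafe U e st \<Longrightarrow> asize e \<le> 20 \<Longrightarrow> mem P st + aspace e st \<le> K"
  using space_expr[of st] order_trans[OF aspace_le mult_le_mono1] by blast

lemma space_bexp:
  "bounded U (st :: 'a state) \<Longrightarrow> bsafe U b st \<Longrightarrow> bsize b \<le> 20 \<Longrightarrow> mem P st + bspace b st \<le> K"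
  using space_expr[of st] order_trans[OF bspace_le mult_le_mono1] by blast

lemma space_mem: "bounded U (st :: 'a state) \<Longrightarrow> mem P st \<le> K"
  using space_expr[of st 0] by simp

section \<open>Proof rules for the program constructs\<close>

lemma ok_Skip: "Q st \<Longrightarrow> ok Skip st Q"
  by (rule okI[OF run.Skip]) (auto intro: space_mem)

lemma ok_Assign:
  assumes "asize e \<le> 20" "bounded U st \<Longrightarrow> asafe U e st" "Q (st\<lparr>reg := (reg st)(r := aval e st)\<rparr>)"
  shows "ok (Assign r e) st Q"
proof (rule okI[OF run.Assign[OF refl]])
  let ?st = "st\<lparr>reg := (reg st)(r := aval e st)\<rparr>"
  assume b: "bounded U st"
  then show b': "bounded U ?st"
    using aval_less[OF b assms(2)[OF b]] by (simp add: bounded_def)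
  show "max (mem P st + aspace e st) (mem P ?st) \<le> K"
    using space_aexp[OF b assms(2)[OF b] assms(1)] space_mem[OF b'] by simp
qed (rule assms(3))

lemma ok_Query:
  assumes "asize e \<le> 20" "bounded U st \<Longrightarrow> asafe U e st"
    "Q (st\<lparr>chr := (chr st)(c := (if aval e st < length off then Some (off ! aval e st) else None))\<rparr>)"
  shows "ok (Query c e) st Q"
proof (rule okI[OF run.Query[OF refl refl]])
  let ?st = "st\<lparr>chr := (chr st)(c := (if aval e st < length off then Some (off ! aval e st) else None))\<rparr>"
  assume b: "bounded U st"
  then show b': "bounded U ?st"
    by (simp add: bounded_def)
  show "max (mem P st + aspace e st) (mem P ?st) \<le> K"
    using space_aexp[OF b assms(2)[OF b] assms(1)] space_mem[OF b'] by simp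
qed (rule assms(3))

lemma ok_Read:
  assumes "Q (st\<lparr>chr := (chr st)(c := (case stream st of [] \<Rightarrow> None | a # _ \<Rightarrow> Some a)),
    stream := tl (stream st)\<rparr>)"
  shows "ok (Read c) st Q"
proof (rule okI)
  let ?st = "st\<lparr>chr := (chr st)(c := (case stream st of [] \<Rightarrow> None | a # _ \<Rightarrow> Some a)),
    stream := tl (stream st)\<rparr>"
  assume b: "bounded U st"
  then show b': "bounded U ?st"
    by (simp add: bounded_def)
  show "run P off (Read c) st ?st (max (mem P st) (mem P ?st))"
  proof (cases "stream st")
    case Nil
    then show ?thesis by (intro run.Read_end) auto
  next
    case (Cons a rest)
    then show ?thesis by (intro run.Read[of st a rest]) auto
  qed
  show "max (mem P st) (mem P ?st) \<le> K"
    using space_mem[OF b] space_mem[OF b'] by simp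
qed (rule assms)

lemma ok_Seq:
  assumes "ok p st (\<lambda>st'. ok q st' Q)"
  shows "ok (Seq p q) st Q"
  unfolding ok_def
proof
  assume "bounded U st"
  with assms obtain st' m where 1: "run P off p st st' m" "m \<le> K" "bounded U st'" "ok q st' Q"
    by (rule okE)
  from 1(4,3) obtain st'' m' where 2: "run P off q st' st'' m'" "m' \<le> K" "bounded U st''" "Q st''"
    by (rule okE)
  have "max m m' \<le> K"
    using 1 2 by simp
  then show "\<exists>st' m. run P off (Seq p q) st st' m \<and> m \<le> K \<and> bounded U st' \<and> Q st'"
    using run.Seq[OF 1(1) 2(1)] 2 by blast
qed

lemma ok_Cond:
  assumes "bsize b \<le> 20" "bounded U st \<Longrightarrow> bsafe U b st"
    "bval b st \<Longrightarrow> ok p st Q" "\<not> bval b st \<Longrightarrow> ok q st Q"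
  shows "ok (Cond b p q) st Q"
  unfolding ok_def
proof
  assume b: "bounded U st"
  have s: "mem P st + bspace b st \<le> K"
    by (rule space_bexp[OF b assms(2)[OF b] assms(1)])
  show "\<exists>st' m. run P off (Cond b p q) st st' m \<and> m \<le> K \<and> bounded U st' \<and> Q st'"
  proof (cases "bval b st")
    case True
    from assms(3)[OF True] b obtain st' m where 1: "run P off p st st' m" "m \<le> K" "bounded U st'" "Q st'"
      by (rule okE)
    have "max (mem P st + bspace b st) m \<le> K"
      using s 1 by simp
    with run.Cond_true[OF True 1(1), of q] 1 show ?thesis by blast
  next
    case False
    from assms(4)[OF False] b obtain st' m where 1: "run P off q st st' m" "m \<le> K" "bounded U st'" "Q st'"
      by (rule okE)
    have "max (mem P st + bspace b st) m \<le> K"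
      using s 1 by simp
    with run.Cond_false[OF False 1(1), of p] 1 show ?thesis by blast
  qed
qed

lemma ok_Loop_unfold:
  assumes "bsize b \<le> 20" "bounded U st \<Longrightarrow> bsafe U b st"
    "bval b st \<Longrightarrow> ok p st (\<lambda>st'. ok (Loop b p) st' Q)" "\<not> bval b st \<Longrightarrow> Q st"
  shows "ok (Loop b p) st Q"
  unfolding ok_def
proof
  assume b: "bounded U st"
  have s: "mem P st + bspace b st \<le> K"
    by (rule space_bexp[OF b assms(2)[OF b] assms(1)])
  show "\<exists>st' m. run P off (Loop b p) st st' m \<and> m \<le> K \<and> bounded U st' \<and> Q st'"
  proof (cases "bval b st")
    case True
    from assms(3)[OF True] b obtain st' m where 1: "run P off p st st' m" "m \<le> K" "bounded U st'"
        "ok (Loop b p) st' Q"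
      by (rule okE)
    from 1(4,3) obtain st'' m' where 2: "run P off (Loop b p) st' st'' m'" "m' \<le> K" "bounded U st''" "Q st''"
      by (rule okE)
    have "max (mem P st + bspace b st) (max m m') \<le> K"
      using s 1 2 by simp
    with run.Loop_step[OF True 1(1) 2(1)] 2 show ?thesis by blast
  next
    case False
    with run.Loop_exit[OF False, of P off p] s b assms(4)[OF False] show ?thesis by blast
  qed
qed

text \<open>\<open>Inv t\<close> describes the states in which the counter is \<open>t\<close>. The
  frame relates each of them to the state before the loop, so loop constants need not be part of the
  invariant.\<close>

lemma ok_countdown:
  assumes T: "T \<notin> writes p"
    and init: "Inv (reg st T) st"
    and step: "\<And>t s. Inv (Suc t) s \<Longrightarrow> t < reg st T \<Longrightarrow> reg s T = Suc t \<Longrightarrow>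
      frame (countdown T p) st s \<Longrightarrow> ok p (s\<lparr>reg := (reg s)(T := t)\<rparr>) (Inv t)"
    and final: "\<And>s. Inv 0 s \<Longrightarrow> frame (countdown T p) st s \<Longrightarrow> Q s"
  shows "ok (countdown T p) st Q"
proof -
  have "ok (countdown T p) s Q"
    if "Inv t s" "frame (countdown T p) st s" "reg s T = t" "t \<le> reg st T" for t s
    using that
  proof (induction t arbitrary: s)
    case 0
    then show ?case
      using U_gt_1 final unfolding countdown_def
      by (intro ok_Loop_unfold) auto
  next
    case (Suc t)
    let ?s = "s\<lparr>reg := (reg s)(T := t)\<rparr>"
    have "ok p ?s (\<lambda>s'. ok (countdown T p) s' Q)"
    proof (rule ok_consequence[OF step])
      fix s' assume s': "Inv t s'" "frame p ?s s'"
      show "ok (countdown T p) s' Q"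
      proof (rule Suc.IH)
        show "frame (countdown T p) st s'" "reg s' T = t"
          using s'(2) Suc.prems(2) T by (auto simp: frame_def)
      qed (use s' Suc.prems in auto)
    qed (use Suc.prems in auto)
    then show ?case
      using U_gt_1 Suc.prems unfolding countdown_def
      by (intro ok_Loop_unfold ok_Seq ok_Assign) auto
  qed
  from this[OF init _ refl] show ?thesis
    by (simp add: frame_def)
qed

end

section \<open>Substrings and encoded sequences of substrings\<close>

definition sub :: "'a list \<Rightarrow> nat \<Rightarrow> nat \<Rightarrow> 'a list" where
  "sub y i j = take (j - i) (drop i y)"

lemma length_sub: "j \<le> length y \<Longrightarrow> length (sub y i j) = j - i"
  by (simp add: sub_def)

lemma sub_empty [simp]: "sub y i i = []"
  by (simp add: sub_def)

lemma sub_all: "sub y 0 (length y) = y"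
  by (simp add: sub_def)

lemma set_sub_subset: "set (sub y i j) \<subseteq> set y"
  unfolding sub_def using set_take_subset set_drop_subset by (metis subset_trans)

lemma sub_Suc: "i < length y \<Longrightarrow> sub y i (Suc i) = [y ! i]"
  by (simp add: sub_def take_Suc_conv_app_nth)

lemma set_sub: "j \<le> length y \<Longrightarrow> set (sub y i j) = {y ! p | p. i \<le> p \<and> p < j}"
proof -
  assume j: "j \<le> length y"
  have "set (sub y i j) = {sub y i j ! p | p. p < j - i}"
    using j by (auto simp: set_conv_nth length_sub)
  also have "\<dots> = {y ! (i + p) | p. p < j - i}"
    using j by (intro Collect_cong ex_cong1) (auto simp: sub_def)
  also have "\<dots> = {y ! p | p. i \<le> p \<and> p < j}"
  proof (intro set_eqI iffI)
    fix a assume "a \<in> {y ! p | p. i \<le> p \<and> p < j}"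
    then obtain p where "a = y ! p" "i \<le> p" "p < j"
      by blast
    then show "a \<in> {y ! (i + p) | p. p < j - i}"
      by (intro CollectI exI[of _ "p - i"]) auto
  qed (force intro: le_add1)
  finally show ?thesis .
qed

lemma sub_append:
  assumes "i \<le> m" "m \<le> j"
  shows "sub y i m @ sub y m j = sub y i j"
  using assms take_add[of "m - i" "j - m" "drop i y"] by (simp add: sub_def)

lemma sub_split:
  assumes "sub y i j = z1 @ z2" "i \<le> j" "j \<le> length y"
  obtains m where "i \<le> m" "m \<le> j" "z1 = sub y i m" "z2 = sub y m j"
proof
  let ?m = "i + length z1"
  have len: "length z1 + length z2 = j - i"
    using assms(1,3) length_sub[of j y i] by simp
  then show "i \<le> ?m" "?m \<le> j"
    using assms(2) by auto
  then have "sub y i ?m @ sub y ?m j = z1 @ z2"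
    using sub_append[of i ?m j y] assms(1) by simp
  moreover have "length (sub y i ?m) = length z1"
    using \<open>?m \<le> j\<close> assms(3) by (simp add: length_sub)
  ultimately show "z1 = sub y i ?m" "z2 = sub y ?m j"
    by auto
qed

lemma ed_sub_le: "ed (sub y i j) (sub y i' j') \<le> length y"
  by (rule order_trans[OF ed_le_max]) (auto simp: sub_def min_def)

text \<open>
  A number \<open>Z\<close> encodes a stack of \<open>t\<close> intervals \<open>l, r\<close> by base-\<open>M\<close> digits, the last interval being
  the least significant one; \<open>pieces y M t Z\<close> is the concatenation of the corresponding
  substrings of \<open>y\<close>.
\<close>

fun pieces :: "'a list \<Rightarrow> nat \<Rightarrow> nat \<Rightarrow> nat \<Rightarrow> 'a list" where
  "pieces y M 0 Z = []"
| "pieces y M (Suc t) Z = pieces y M t (Z div M div M) @ sub y (Z div M mod M) (Z mod M)"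

text \<open>The parameter \<open>q\<close> is the greatest length of a piece that the distance
  program one level below can handle.\<close>

fun valid :: "nat \<Rightarrow> nat \<Rightarrow> nat \<Rightarrow> nat \<Rightarrow> bool" where
  "valid M q 0 Z = True"
| "valid M q (Suc t) Z =
     (Z div M mod M \<le> Z mod M \<and> Z mod M - Z div M mod M \<le> q \<and> valid M q t (Z div M div M))"

lemma push_digits:
  fixes M :: nat
  assumes "l < M" "r < M"
  shows "((Z * M + l) * M + r) mod M = r" "((Z * M + l) * M + r) div M = Z * M + l"
    "(Z * M + l) mod M = l" "(Z * M + l) div M = Z"
  using assms by simp_all

lemma pieces_push:
  assumes "l < M" "r < M"
  shows "pieces y M (Suc t) ((Z * M + l) * M + r) = pieces y M t Z @ sub y l r"
  using push_digits[OF assms] by simp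

lemma valid_push:
  assumes "l < M" "r < M"
  shows "valid M q (Suc t) ((Z * M + l) * M + r) \<longleftrightarrow> l \<le> r \<and> r - l \<le> q \<and> valid M q t Z"
  using push_digits[OF assms] by simp

lemma push_less:
  fixes M :: nat
  assumes "Z < M ^ (2 * t)" "l < M" "r < M"
  shows "(Z * M + l) * M + r < M ^ (2 * Suc t)"
proof -
  have "Suc ((Z * M + l) * M + r) \<le> (Z * M + l) * M + M"
    using assms(3) by simp
  also have "\<dots> = Suc (Z * M + l) * M"
    by simp
  also have "\<dots> \<le> (Suc Z * M) * M"
    using assms(2) by (intro mult_le_mono1) simp
  also have "\<dots> \<le> (M ^ (2 * t) * M) * M"
    using assms(1) by (intro mult_le_mono1) simp
  finally show ?thesis
    by (simp add: ac_simps)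
qed

text \<open>
  The base-\<open>M\<close> digits of \<open>X\<close> prescribe the lengths of the parts of \<open>sub y I J\<close> that are matched
  with the pieces, starting from the right. The truncation at \<open>I\<close> makes every \<open>X\<close> meaningful;
  whatever is left in the end is inserted.
\<close>

fun cost :: "'a list \<Rightarrow> nat \<Rightarrow> nat \<Rightarrow> nat \<Rightarrow> nat \<Rightarrow> nat \<Rightarrow> nat \<Rightarrow> nat" where
  "cost y M I 0 Z X J = J - I"
| "cost y M I (Suc t) Z X J =
     ed (sub y (Z div M mod M) (Z mod M)) (sub y (max I (J - X mod M)) J) +
     cost y M I t (Z div M div M) (X div M) (max I (J - X mod M))"

lemma cost_le:
  "I \<le> J \<Longrightarrow> J \<le> length y \<Longrightarrow> cost y M I t Z X J \<le> t * length y + length y"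
proof (induction t arbitrary: Z X J)
  case (Suc t)
  let ?J = "max I (J - X mod M)"
  have "I \<le> ?J" "?J \<le> length y"
    using Suc.prems by auto
  from Suc.IH[OF this, of "Z div M div M" "X div M"]
    ed_sub_le[of y "Z div M mod M" "Z mod M" ?J J]
  show ?case by simp
qed simp

text \<open>Every \<open>X\<close>, after truncation, describes a genuine cut of
  \<open>sub y I J\<close>, whose parts can be aligned separately. With \<open>cost_le_ed\<close>,
  the minimum of \<open>cost\<close> over \<open>X < M ^ t\<close> is the exact distance.\<close>

lemma ed_le_cost:
  "I \<le> J \<Longrightarrow> J \<le> length y \<Longrightarrow> ed (pieces y M t Z) (sub y I J) \<le> cost y M I t Z X J"
proof (induction t arbitrary: Z X J)
  case 0
  then show ?case by (simp add: ed_Nil length_sub)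
next
  case (Suc t)
  let ?J = "max I (J - X mod M)"
  have J: "I \<le> ?J" "?J \<le> J"
    using Suc.prems by auto
  then have "ed (pieces y M t (Z div M div M)) (sub y I ?J)
      \<le> cost y M I t (Z div M div M) (X div M) ?J"
    using Suc.prems by (intro Suc.IH) auto
  then show ?case
    using ed_append[of "pieces y M t (Z div M div M)" "sub y (Z div M mod M) (Z mod M)"
        "sub y I ?J" "sub y ?J J"] sub_append[OF J, of y]
    by simp
qed

text \<open>An optimal cut exists by \<open>ed_append_split\<close>, and the lengths of its parts
  are at most \<open>length y < M\<close>, so that they are base-\<open>M\<close> digits.\<close>

lemma cost_le_ed:
  assumes "I \<le> J" "J \<le> length y" "length y < M"
  shows "\<exists>X<M ^ t. cost y M I t Z X J \<le> ed (pieces y M t Z) (sub y I J)"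
  using assms(1,2)
proof (induction t arbitrary: Z J)
  case 0
  then show ?case by (simp add: ed_Nil length_sub)
next
  case (Suc t)
  let ?W = "pieces y M t (Z div M div M)" and ?p = "sub y (Z div M mod M) (Z mod M)"
  obtain z1 z2 where z: "sub y I J = z1 @ z2" "ed ?W z1 + ed ?p z2 \<le> ed (?W @ ?p) (sub y I J)"
    by (rule ed_append_split)
  obtain m where m: "I \<le> m" "m \<le> J" "z1 = sub y I m" "z2 = sub y m J"
    using sub_split[OF z(1) Suc.prems] .
  obtain X where X: "X < M ^ t"
      "cost y M I t (Z div M div M) X m \<le> ed ?W (sub y I m)"
    using Suc.IH[of m "Z div M div M"] m Suc.prems by auto
  \<comment> \<open>The rightmost part is matched first, so its length is the least significant
    digit.\<close>
  let ?X = "X * M + (J - m)"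
  have less: "J - m < M"
    using Suc.prems assms(3) by simp
  then have "?X mod M = J - m" "?X div M = X"
    by simp_all
  moreover have "max I (J - (J - m)) = m"
    using m by simp
  ultimately have "cost y M I (Suc t) Z ?X J \<le> ed (pieces y M (Suc t) Z) (sub y I J)"
    using X(2) z(2) m by simp
  moreover have "?X < M ^ Suc t"
  proof -
    have "?X < Suc X * M"
      using less by simp
    also have "\<dots> \<le> M ^ t * M"
      using X(1) by (intro mult_le_mono1) simp
    finally show ?thesis by (simp add: mult.commute)
  qed
  ultimately show ?case by blast
qed

text \<open>
  The substring \<open>w\<close> may replace the block \<open>x\<close> of the online string at cost \<open>v\<close>, which is optimal up
  to the factor \<open>C\<close>.
\<close>

definition approx :: "'a list \<Rightarrow> nat \<Rightarrow> 'a list \<Rightarrow> 'a list \<Rightarrow> nat \<Rightarrow> bool" where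
  "approx y C x w v \<longleftrightarrow>
     ed x w \<le> v \<and> (\<forall>l r. l \<le> r \<longrightarrow> r \<le> length y \<longrightarrow> v \<le> C * ed x (sub y l r))"

lemma approx_Nil: "approx y C [] [] 0"
  by (simp add: approx_def)

text \<open>Cutting a substring of \<open>y\<close> yields two substrings of \<open>y\<close>, each
  of which competes with one block. Hence concatenation does not worsen the factor, however many
  blocks are joined.\<close>

lemma approx_append:
  assumes "approx y C x w v" "approx y C x' w' v'"
  shows "approx y C (x @ x') (w @ w') (v + v')"
  unfolding approx_def
proof (intro conjI allI impI)
  show "ed (x @ x') (w @ w') \<le> v + v'"
    using ed_append[of x x' w w'] assms by (simp add: approx_def)
next
  fix l r assume lr: "l \<le> r" "r \<le> length y"
  obtain z1 z2 where z: "sub y l r = z1 @ z2" "ed x z1 + ed x' z2 \<le> ed (x @ x') (sub y l r)"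
    by (rule ed_append_split)
  obtain m where m: "l \<le> m" "m \<le> r" "z1 = sub y l m" "z2 = sub y m r"
    using sub_split[OF z(1) lr] .
  then have "v \<le> C * ed x z1" "v' \<le> C * ed x' z2"
    using assms lr by (auto simp: approx_def)
  then have "v + v' \<le> C * (ed x z1 + ed x' z2)"
    by (simp add: distrib_left)
  also have "\<dots> \<le> C * ed (x @ x') (sub y l r)"
    by (intro mult_le_mono2 z(2))
  finally show "v + v' \<le> C * ed (x @ x') (sub y l r)" .
qed

text \<open>For every substring \<open>z\<close> of \<open>y\<close>, passing through
  \<open>x\<close> gives \<open>V \<le> v + ed x z\<close>. The total is at most
  \<open>2 * v + ed x z\<close>, and \<open>v \<le> C * ed x z\<close>.\<close>

lemma approx_merge:
  assumes "approx y C x w v" "ed w w' \<le> V"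
    and min: "\<And>l r. l \<le> r \<Longrightarrow> r \<le> length y \<Longrightarrow> V \<le> ed w (sub y l r)"
  shows "approx y (2 * C + 1) x w' (v + V)"
  unfolding approx_def
proof (intro conjI allI impI)
  show "ed x w' \<le> v + V"
    using ed_triangle[of x w' w] assms by (simp add: approx_def)
next
  fix l r assume lr: "l \<le> r" "r \<le> length y"
  have "V \<le> ed w x + ed x (sub y l r)"
    using min[OF lr] ed_triangle[of w "sub y l r" x] by simp
  moreover have "ed w x \<le> v" "v \<le> C * ed x (sub y l r)"
    using assms(1) lr by (auto simp: approx_def ed_sym)
  ultimately show "v + V \<le> (2 * C + 1) * ed x (sub y l r)"
    by (simp add: algebra_simps)
qed

section \<open>Distances of offline substrings\<close>

definition rg :: "nat \<Rightarrow> nat \<Rightarrow> nat" where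
  "rg h f = prod_encode (h, f)"

lemma rg_eq [simp]: "rg h f = rg h' f' \<longleftrightarrow> h = h' \<and> f = f'"
  by (simp add: rg_def)

text \<open>The machine puts the input length into register 0 and expects the output there, so
  \<open>rn\<close> must coincide with it.\<close>

lemma rg_0: "rg 0 0 = 0"
  by (simp add: rg_def prod_encode_def)

text \<open>
  Register \<open>rg 0 f\<close> is global: the length \<open>n\<close>, the accumulated distance \<open>D\<close>, the base \<open>M = n + 1\<close>,
  the arity \<open>b\<close>, the number \<open>W = M\<^sup>b\<close> of enumerated cuts, and two auxiliary registers. Register
  \<open>rg (Suc h) f\<close> belongs to the h-th level. The program for level \<open>h\<close> stores the distance of
  \<open>sub y A C\<close> and \<open>sub y I J\<close> in \<open>V\<close>.
\<close>

abbreviation "rn \<equiv> rg 0 0"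
abbreviation "rD \<equiv> rg 0 2"
abbreviation "rM \<equiv> rg 0 3"
abbreviation "rb \<equiv> rg 0 4"
abbreviation "rW \<equiv> rg 0 5"
abbreviation "rp \<equiv> rg 0 6"
abbreviation "rt \<equiv> rg 0 7"

abbreviation "rA h \<equiv> rg (Suc h) 0"
abbreviation "rC h \<equiv> rg (Suc h) 2"
abbreviation "rI h \<equiv> rg (Suc h) 3"
abbreviation "rJ h \<equiv> rg (Suc h) 4"
abbreviation "rV h \<equiv> rg (Suc h) 5"
abbreviation "rN h \<equiv> rg (Suc h) 6"
abbreviation "rX h \<equiv> rg (Suc h) 7"
abbreviation "rY h \<equiv> rg (Suc h) 8"
abbreviation "rS h \<equiv> rg (Suc h) 9"
abbreviation "rT h \<equiv> rg (Suc h) 10"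
abbreviation "rZ h \<equiv> rg (Suc h) 11"

text \<open>The fields below 5 on level \<open>h\<close> hold the arguments \<open>A\<close>,
  \<open>C\<close>, \<open>I\<close>, \<open>J\<close> and survive a call. Fields from 12 on are
  reserved for the online levels.\<close>

definition scratch :: "nat \<Rightarrow> nat set" where
  "scratch h = {rg (Suc g) f | g f. f < 12 \<and> (g < h \<or> g = h \<and> 5 \<le> f)}"

lemma rg_scratch [simp]:
  "rg 0 f \<notin> scratch h"
  "rg (Suc g) f \<in> scratch h \<longleftrightarrow> f < 12 \<and> (g < h \<or> g = h \<and> 5 \<le> f)"
  by (auto simp: scratch_def)

abbreviation max_exp :: "aexp \<Rightarrow> aexp \<Rightarrow> aexp" where
  "max_exp e f \<equiv> Add e (Sub f e)"

lemma add_diff_eq_max [simp]: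
  fixes x z :: nat
  shows "x + (z - x) = max x z" "x + (z - (m + x)) = max x (z - m)"
  by auto

notation Seq (infixr ";;" 60)
notation Assign ("_ ::= _" [65, 65] 65)

text \<open>The default is the distance for a left string that is empty or whose letter does not
  occur in \<open>sub y I J\<close>. The scan looks for an occurrence, which saves one edit
  (\<open>ed_singleton\<close>).\<close>

definition ed_base :: com where
  "ed_base =
     rV 0 ::= max_exp (Sub (Reg (rC 0)) (Reg (rA 0))) (Sub (Reg (rJ 0)) (Reg (rI 0)));;
     Query 0 (Reg (rA 0));;
     rN 0 ::= Reg (rJ 0);;
     countdown (rN 0)
       (Query 1 (Reg (rN 0));;
        Cond (Conj (SameChar 0 1)
               (Conj (Less (Reg (rA 0)) (Reg (rC 0))) (Neg (Less (Reg (rN 0)) (Reg (rI 0))))))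
          (rV 0 ::= Sub (Sub (Reg (rJ 0)) (Reg (rI 0))) (Num 1))
          Skip)"

text \<open>One unfolding of \<open>cost\<close>, popping an interval from \<open>Y\<close> and a
  digit from \<open>X\<close>. These are copies, since the stack \<open>Z\<close> and the counter
  \<open>N\<close> have to outlive the evaluation of one cut.\<close>

definition match_body :: "nat \<Rightarrow> com \<Rightarrow> com" where
  "match_body h e =
     rC h ::= Mod (Reg (rY (Suc h))) (Reg rM);;
     rA h ::= Mod (Div (Reg (rY (Suc h))) (Reg rM)) (Reg rM);;
     rY (Suc h) ::= Div (Div (Reg (rY (Suc h))) (Reg rM)) (Reg rM);;
     rI h ::= max_exp (Reg (rI (Suc h))) (Sub (Reg (rJ h)) (Mod (Reg (rX (Suc h))) (Reg rM)));;
     rX (Suc h) ::= Div (Reg (rX (Suc h))) (Reg rM);;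
     e;;
     rS (Suc h) ::= Add (Reg (rS (Suc h))) (Reg (rV h));;
     rJ h ::= Reg (rI h)"

definition match_prog :: "nat \<Rightarrow> com \<Rightarrow> com" where
  "match_prog h e =
     rS (Suc h) ::= Num 0;;
     rX (Suc h) ::= Reg (rN (Suc h));;
     rY (Suc h) ::= Reg (rZ (Suc h));;
     rJ h ::= Reg (rJ (Suc h));;
     rT (Suc h) ::= Reg rb;;
     countdown (rT (Suc h)) (match_body h e);;
     rS (Suc h) ::= Add (Reg (rS (Suc h))) (Sub (Reg (rJ h)) (Reg (rI (Suc h))))"

text \<open>The start value is no smaller than any cost (\<open>cost_le\<close>); the loop then
  takes the minimum over all \<open>W\<close> encoded cuts.\<close>

definition merge_prog :: "nat \<Rightarrow> com \<Rightarrow> com" where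
  "merge_prog h e =
     rV (Suc h) ::= Add (Mul (Reg rb) (Reg rM)) (Reg rM);;
     rN (Suc h) ::= Reg rW;;
     countdown (rN (Suc h))
       (match_prog h e;;
        Cond (Less (Reg (rS (Suc h))) (Reg (rV (Suc h))))
          (rV (Suc h) ::= Reg (rS (Suc h)))
          Skip)"

text \<open>With truncated subtraction, \<open>C - (C - (X + S))\<close> is the minimum of
  \<open>C\<close> and \<open>X + S\<close>.\<close>

definition split_body :: "nat \<Rightarrow> com" where
  "split_body h =
     rY h ::= Sub (Reg (rC h)) (Sub (Reg (rC h)) (Add (Reg (rX h)) (Reg (rS h))));;
     rZ h ::= Add (Mul (Add (Mul (Reg (rZ h)) (Reg rM)) (Reg (rX h))) (Reg rM)) (Reg (rY h));;
     rX h ::= Reg (rY h)"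

text \<open>The step \<open>S\<close> is \<open>(C - A) / b\<close> rounded up, so that
  \<open>b\<close> steps reach \<open>C\<close>; the last pieces may be shorter or empty.\<close>

definition split_prog :: "nat \<Rightarrow> com" where
  "split_prog h =
     rS h ::= Div (Add (Sub (Reg (rC h)) (Reg (rA h))) (Sub (Reg rb) (Num 1))) (Reg rb);;
     rZ h ::= Num 0;;
     rX h ::= Reg (rA h);;
     rT h ::= Reg rb;;
     countdown (rT h) (split_body h)"

fun ed_prog :: "nat \<Rightarrow> com" where
  "ed_prog 0 = ed_base"
| "ed_prog (Suc h) = split_prog (Suc h);; merge_prog h (ed_prog h)"

lemma reads_ed_prog [simp]: "\<not> reads (ed_prog h)"
  by (induction h)
    (auto simp: ed_base_def split_prog_def split_body_def merge_prog_def match_prog_def match_body_def)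

lemma writes_match_prog: "writes (match_prog h e) =
    {rS (Suc h), rX (Suc h), rY (Suc h), rT (Suc h), rC h, rA h, rI h, rJ h} \<union> writes e"
  by (auto simp: match_prog_def match_body_def)

lemma writes_merge_prog: "writes (merge_prog h e) =
    {rV (Suc h), rN (Suc h)} \<union> writes (match_prog h e)"
  by (auto simp: merge_prog_def)

lemma writes_split_prog: "writes (split_prog h) = {rS h, rX h, rY h, rZ h, rT h}"
  by (auto simp: split_prog_def split_body_def)

lemma writes_ed_prog: "writes (ed_prog h) \<subseteq> scratch h"
proof (induction h)
  case 0
  show ?case by (simp add: ed_base_def)
next
  case (Suc h)
  have "scratch h \<subseteq> scratch (Suc h)"
    by (auto simp: scratch_def)
  with Suc show ?case
    by (auto simp: writes_split_prog writes_merge_prog writes_match_prog)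
qed

section \<open>Correctness of the distance programs\<close>

locale ed_space = space_bounded P y U K for P :: com and y :: "'a list" and U K :: nat +
  fixes n b :: nat
  assumes length_y: "length y = n"
    and b_pos: "1 \<le> b"
    and U_ge: "(n + 2) ^ (2 * b + 6) \<le> U"
begin

lemma U_linear: "(b + 4) * ((n + 2) * (n + 2)) < U"
proof -
  have c4: "c ^ (b + 2) * (c * c) = c ^ (b + 4)" for c :: nat
    by (simp add: power_add eval_nat_numeral)
  \<comment> \<open>The linear factor is absorbed into a power. The base \<open>n + 2\<close> is at
    least 2 even for \<open>n = 0\<close>.\<close>
  have "b + 4 \<le> 2 ^ (b + 2)"
    by (induction b) auto
  also have "\<dots> \<le> (n + 2) ^ (b + 2)"
    by (rule power_mono) auto
  finally have "(b + 4) * ((n + 2) * (n + 2)) \<le> (n + 2) ^ (b + 2) * ((n + 2) * (n + 2))"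
    by (rule mult_le_mono1)
  also have "\<dots> = (n + 2) ^ (b + 4)"
    by (rule c4)
  also have "\<dots> < (n + 2) ^ (2 * b + 6)"
    by (rule power_strict_increasing) auto
  finally show ?thesis
    using U_ge by simp
qed

lemma U_bounds: "b * n + b + 3 * n + 3 < U" "(n + 1) * (n + 1) < U"
proof -
  have "(b + 4) * (n + 2) \<le> (b + 4) * ((n + 2) * (n + 2))"
    by (rule mult_le_mono2) simp
  then show "b * n + b + 3 * n + 3 < U"
    using U_linear by (simp add: algebra_simps)
  have "(n + 1) * (n + 1) \<le> 1 * ((n + 2) * (n + 2))"
    by simp
  also have "\<dots> \<le> (b + 4) * ((n + 2) * (n + 2))"
    by (rule mult_le_mono1) simp
  finally show "(n + 1) * (n + 1) < U"
    using U_linear by simp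
qed

lemma U_power: "(n + 1) ^ (2 * b) < U"
proof -
  have "(n + 1) ^ (2 * b) \<le> (n + 2) ^ (2 * b)"
    by (rule power_mono) auto
  also have "\<dots> < (n + 2) ^ (2 * b + 6)"
    by (rule power_strict_increasing) auto
  finally show ?thesis
    using U_ge by simp
qed

definition env :: "'a state \<Rightarrow> bool" where
  "env st \<longleftrightarrow> reg st rn = n \<and> reg st rM = n + 1 \<and> reg st rb = b \<and> reg st rW = (n + 1) ^ b"

lemma env_frame: "env st \<Longrightarrow> frame p st s \<Longrightarrow> {rn, rM, rb, rW} \<inter> writes p = {} \<Longrightarrow> env s"
  by (auto simp: env_def frame_def)

definition computes_ed :: "nat \<Rightarrow> com \<Rightarrow> bool" where
  "computes_ed h e \<longleftrightarrow> writes e \<subseteq> scratch h \<and>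
     (\<forall>st. env st \<longrightarrow> reg st (rA h) \<le> reg st (rC h) \<longrightarrow> reg st (rC h) \<le> n \<longrightarrow>
        reg st (rC h) - reg st (rA h) \<le> b ^ h \<longrightarrow>
        reg st (rI h) \<le> reg st (rJ h) \<longrightarrow> reg st (rJ h) \<le> n \<longrightarrow>
        ok e st (\<lambda>s. reg s (rV h) =
          ed (sub y (reg st (rA h)) (reg st (rC h))) (sub y (reg st (rI h)) (reg st (rJ h)))))"

lemma match_prog_ok:
  assumes e: "computes_ed h e" and "env st"
    and "reg st (rI (Suc h)) \<le> reg st (rJ (Suc h))" "reg st (rJ (Suc h)) \<le> n"
    and "valid (n + 1) (b ^ h) b (reg st (rZ (Suc h)))"
  shows "ok (match_prog h e) st (\<lambda>s. reg s (rS (Suc h)) =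
    cost y (n + 1) (reg st (rI (Suc h))) b (reg st (rZ (Suc h))) (reg st (rN (Suc h))) (reg st (rJ (Suc h))))"
proof -
  define I J Z N where vars: "I = reg st (rI (Suc h))" "J = reg st (rJ (Suc h))"
    "Z = reg st (rZ (Suc h))" "N = reg st (rN (Suc h))"
  \<comment> \<open>The sum so far plus the cost of the remaining \<open>t\<close> pieces is the
    full cost. The last conjunct grants \<open>n\<close> to each remaining piece, which keeps the
    sum below \<open>U\<close>.\<close>
  define Inv where "Inv t s \<longleftrightarrow> 
     reg s (rS (Suc h)) + cost y (n + 1) I t (reg s (rY (Suc h))) (reg s (rX (Suc h))) (reg s (rJ h))
       = cost y (n + 1) I b Z N J \<and>
     I \<le> reg s (rJ h) \<and> reg s (rJ h) \<le> J \<and> valid (n + 1) (b ^ h) t (reg s (rY (Suc h))) \<and>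
     reg s (rS (Suc h)) + t * n \<le> b * n" for t and s :: "'a state"
  have W: "writes e \<subseteq> scratch h"
    using e by (simp add: computes_ed_def)
  have nW: "rg 0 f \<notin> writes e" "rg (Suc (Suc h)) f \<notin> writes e" "f < 5 \<Longrightarrow> rg (Suc h) f \<notin> writes e" for f
    using W by (auto dest: subsetD)
  have cost_less: "cost y (Suc n) I b Z N J < U"
    using cost_le[of I J y "Suc n" b Z N] assms length_y U_bounds vars by simp
  have body: "ok (match_body h e) s (Inv t)"
    if "env s" and I: "reg s (rI (Suc h)) = I" and Inv: "Inv (Suc t) s" for t s
  proof -
    let ?Y = "reg s (rY (Suc h))" and ?X = "reg s (rX (Suc h))" and ?J = "reg s (rJ h)"
    define J' where "J' = max I (?J - ?X mod Suc n)"
    define p where "p = ed (sub y (?Y div Suc n mod Suc n) (?Y mod Suc n)) (sub y J' ?J)"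
    note fold = J'_def[symmetric] p_def[symmetric]
    have J': "I \<le> J'" "J' \<le> ?J" "?J \<le> n" "J' < U" "J' \<le> J"
      using Inv assms(4) vars U_bounds unfolding J'_def by (auto simp: Inv_def)
    have p: "p \<le> n"
      using ed_sub_le[of y] length_y by (simp add: p_def)
    have Inv': "reg s (rS (Suc h)) + (p + cost y (Suc n) I t (?Y div Suc n div Suc n) (?X div Suc n) J')
        = cost y (Suc n) I b Z N J"
      "?Y div Suc n mod Suc n \<le> ?Y mod Suc n" "?Y mod Suc n - ?Y div Suc n mod Suc n \<le> b ^ h"
      "valid (Suc n) (b ^ h) t (?Y div Suc n div Suc n)" "reg s (rS (Suc h)) + (n + t * n) \<le> b * n"
      using Inv by (simp_all add: Inv_def fold)
    show ?thesis
      unfolding match_body_def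
      apply (intro ok_Seq ok_Assign)
                          apply (use I J' \<open>env s\<close> in \<open>simp_all add: env_def fold\<close>)
      \<comment> \<open>The call of \<open>e\<close>: by \<open>valid\<close>, the popped piece has
        length at most \<open>b ^ h\<close>, as \<open>computes_ed\<close> demands.\<close>
      apply (rule ok_consequence[OF e[unfolded computes_ed_def, THEN conjunct2, rule_format]])
            apply (use I J' Inv' \<open>env s\<close> in \<open>simp_all add: env_def fold\<close>)
      apply (intro ok_Seq ok_Assign)
           apply (use I J' Inv' p U_bounds(1) in \<open>simp_all add: Inv_def frame_def nW fold\<close>)
      done
  qed
  show ?thesis
    unfolding match_prog_def
    apply (intro ok_Seq ok_Assign)
    apply simp_all
  proof (rule ok_countdown[where Inv = Inv], goal_cases)
    case 1
    show ?case by (simp add: match_body_def nW)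
  next
    case 2
    show ?case using assms vars by (simp add: Inv_def env_def)
  next
    case (3 t s)
    show ?case
      using 3(1,4) \<open>env st\<close> by (intro body) (simp_all add: Inv_def env_def vars frame_def match_body_def nW)
  next
    case (4 s)
    show ?case
      using 4 cost_less by (intro ok_Assign) (simp_all add: Inv_def vars frame_def match_body_def nW)
  qed
qed

lemma merge_prog_ok:
  assumes e: "computes_ed h e" and "env st"
    and "reg st (rI (Suc h)) \<le> reg st (rJ (Suc h))" "reg st (rJ (Suc h)) \<le> n"
    and "valid (n + 1) (b ^ h) b (reg st (rZ (Suc h)))"
  shows "ok (merge_prog h e) st (\<lambda>s. reg s (rV (Suc h)) =
    ed (pieces y (n + 1) b (reg st (rZ (Suc h)))) (sub y (reg st (rI (Suc h))) (reg st (rJ (Suc h)))))"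
proof -
  define I J Z where vars: "I = reg st (rI (Suc h))" "J = reg st (rJ (Suc h))"
    "Z = reg st (rZ (Suc h))"
  define E where "E = ed (pieces y (Suc n) b Z) (sub y I J)"
  define Inv where "Inv t s \<longleftrightarrow> E \<le> reg s (rV (Suc h)) \<and>
     (\<forall>X. t \<le> X \<longrightarrow> X < Suc n ^ b \<longrightarrow> reg s (rV (Suc h)) \<le> cost y (Suc n) I b Z X J)"
    for t and s :: "'a state"
  have IJ: "I \<le> J" "J \<le> length y"
    using assms vars length_y by simp_all
  have W: "writes e \<subseteq> scratch h"
    using e by (simp add: computes_ed_def)
  have nW: "rg 0 f \<notin> writes e" "rg (Suc (Suc h)) f \<notin> writes e" for f
    using W by (auto dest: subsetD)
  have init: "b * Suc n + Suc n < U" "b * Suc n < U"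
    using U_bounds(1) by simp_all
  note env = \<open>env st\<close>[unfolded env_def, simplified]
  have E_le: "E \<le> cost y (Suc n) I b Z X J" for X
    unfolding E_def by (rule ed_le_cost[OF IJ])
  have E_le': "E \<le> b * n + n"
    using E_le[of 0] cost_le[OF IJ, of "Suc n" b Z 0] length_y by simp
  show ?thesis
    unfolding merge_prog_def
    apply (intro ok_Seq ok_Assign)
    apply (simp_all add: env init[simplified])
  proof (rule ok_countdown[where Inv = Inv], goal_cases)
    case 1
    show ?case by (simp add: writes_match_prog nW)
  next
    case 2
    show ?case using E_le' by (simp add: Inv_def)
  next
    case (3 t s)
    then have s: "reg s (rI (Suc h)) = I" "reg s (rJ (Suc h)) = J" "reg s (rZ (Suc h)) = Z"
      "env s"
      using \<open>env st\<close> by (simp_all add: frame_def writes_match_prog nW vars env_def)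
    have "ok (match_prog h e) (s\<lparr>reg := (reg s)(rN (Suc h) := t)\<rparr>)
        (\<lambda>s'. reg s' (rS (Suc h)) = cost y (Suc n) I b Z t J)"
      using match_prog_ok[OF e, of "s\<lparr>reg := (reg s)(rN (Suc h) := t)\<rparr>"] s assms vars
      by (simp add: env_def)
    then show ?case
    proof (rule ok_Seq[OF ok_consequence])
      fix s' assume s': "reg s' (rS (Suc h)) = cost y (Suc n) I b Z t J"
        and F: "frame (match_prog h e) (s\<lparr>reg := (reg s)(rN (Suc h) := t)\<rparr>) s'"
      have V: "reg s' (rV (Suc h)) = reg s (rV (Suc h))"
        using F by (simp add: frame_def writes_match_prog nW)
      have le: "reg s (rV (Suc h)) \<le> cost y (Suc n) I b Z X J" if "t \<le> X" "X \<noteq> t" "X < Suc n ^ b" for X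
        using 3(1) that by (simp add: Inv_def)
      show "ok (Cond (Less (Reg (rS (Suc h))) (Reg (rV (Suc h)))) (rV (Suc h) ::= Reg (rS (Suc h))) Skip) s' (Inv t)"
      proof (intro ok_Cond ok_Assign ok_Skip, goal_cases)
        case 5
        then have "reg s' (rS (Suc h)) \<le> cost y (Suc n) I b Z X J" if "t \<le> X" "X < Suc n ^ b" for X
          using le[of X] that s' V by (cases "X = t") auto
        then show ?case
          using E_le s' by (simp add: Inv_def)
      next
        case 6
        then have "reg s' (rV (Suc h)) \<le> cost y (Suc n) I b Z X J" if "t \<le> X" "X < Suc n ^ b" for X
          using le[of X] that s' V by (cases "X = t") auto
        then show ?case
          using 3(1) V by (simp add: Inv_def)
      qed simp_all
    qed
  next
    case (4 s)
    \<comment> \<open>At counter 0 all cuts have been tried, and one of them attains the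
      distance.\<close>
    obtain X where "X < Suc n ^ b" "cost y (Suc n) I b Z X J \<le> E"
      using cost_le_ed[OF IJ, of "Suc n" b Z] length_y unfolding E_def by auto
    with 4(1) have "reg s (rV (Suc h)) = E"
      by (auto simp: Inv_def intro!: antisym intro: order_trans)
    then show ?case
      by (simp add: E_def vars)
  qed
qed

lemma split_prog_ok:
  assumes "env st" "reg st (rA h) \<le> reg st (rC h)" "reg st (rC h) \<le> n"
    "reg st (rC h) - reg st (rA h) \<le> b * q"
  shows "ok (split_prog h) st (\<lambda>s. valid (Suc n) q b (reg s (rZ h)) \<and>
    pieces y (Suc n) b (reg s (rZ h)) = sub y (reg st (rA h)) (reg st (rC h)))"
proof -
  define A C where vars: "A = reg st (rA h)" "C = reg st (rC h)"
  define d where "d = (C - A + (b - 1)) div b"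
  have AC: "A \<le> C" "C \<le> n"
    using assms vars by auto
  have d: "d \<le> q" "C - A \<le> b * d" "d \<le> n + b"
  proof -
    have "C - A + (b - 1) < b * Suc q"
      using assms(4) b_pos vars by simp
    then show "d \<le> q"
      using less_mult_imp_div_less[of "C - A + (b - 1)" "Suc q" b] unfolding d_def
      by (simp add: mult.commute)
    have "C - A + (b - 1) = b * d + (C - A + (b - 1)) mod b"
      unfolding d_def by simp
    moreover have "(C - A + (b - 1)) mod b < b"
      using b_pos by simp
    ultimately show "C - A \<le> b * d"
      by linarith
    show "d \<le> n + b"
      unfolding d_def using AC by (intro order_trans[OF div_le_dividend]) simp
  qed
  \<comment> \<open>The \<open>b - t\<close> pieces pushed so far concatenate to
    \<open>sub y A X\<close>, with the front \<open>X\<close> stopped at \<open>C\<close>.\<close>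
  define Inv where "Inv t s \<longleftrightarrow> reg s (rX h) = min C (A + (b - t) * d) \<and>
     pieces y (Suc n) (b - t) (reg s (rZ h)) = sub y A (reg s (rX h)) \<and>
     valid (Suc n) q (b - t) (reg s (rZ h)) \<and> reg s (rZ h) < Suc n ^ (2 * (b - t))"
    for t and s :: "'a state"
  have body: "ok (split_body h) s (Inv t)"
    if "env s" "reg s (rC h) = C" "reg s (rS h) = d" "t < b" and Inv: "Inv (Suc t) s" for t s
  proof -
    define i where "i = b - Suc t"
    have i: "b - t = Suc i" "Suc i \<le> b"
      using that(4) by (auto simp: i_def)
    define X Z X' where XZ: "X = reg s (rX h)" "Z = reg s (rZ h)" "X' = C - (C - (X + d))"
    have Inv': "X = min C (A + i * d)" "pieces y (Suc n) i Z = sub y A X"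
        "valid (Suc n) q i Z" "Z < Suc n ^ (2 * i)"
      using Inv by (auto simp: Inv_def XZ i_def)
    have "X' = min C (X + d)"
      unfolding XZ(3) by auto
    then have X: "A \<le> X" "X \<le> X'" "X' - X \<le> q" "X' < Suc n" "X < Suc n" "X' = min C (A + Suc i * d)"
      using AC d Inv'(1) by (auto simp: min_def)
    let ?Z = "(Z * Suc n + X) * Suc n + X'"
    have less: "?Z < Suc n ^ (2 * Suc i)"
      by (rule push_less) (use Inv' X in auto)
    also have "\<dots> \<le> Suc n ^ (2 * b)"
      by (rule power_increasing) (use i in auto)
    finally have Z_U: "?Z < U"
      using U_power by simp
    have Z_U': "(Z * Suc n + X) * Suc n < U" "Z * Suc n + X < U" "Z * Suc n < U"
      using Z_U by simp_all
    have "pieces y (Suc n) (Suc i) ?Z = sub y A X'" "valid (Suc n) q (Suc i) ?Z"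
      unfolding pieces_push[OF X(5,4)] valid_push[OF X(5,4)] Inv'(2)
      using sub_append[OF X(1,2)] X Inv'(3) by auto
    moreover have "X + d < U"
      using X d U_bounds by simp
    ultimately show ?thesis
      unfolding split_body_def
      apply (intro ok_Seq ok_Assign)
      using that(1-3) X(6) less Z_U Z_U'
            apply (simp_all add: env_def Inv_def i XZ[symmetric] del: pieces.simps valid.simps mult_Suc_right mult_Suc power_Suc)
      done
  qed
  have "C - A + (b - 1) < U"
    using AC U_bounds by simp
  note env = \<open>env st\<close>[unfolded env_def, simplified] vars[symmetric] d_def[symmetric, simplified] this[simplified]
  show ?thesis
    unfolding split_prog_def
    apply (intro ok_Seq ok_Assign)
                   apply (simp_all add: env)
  proof (rule ok_countdown[where Inv = Inv], goal_cases)
    case 1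
    show ?case by (simp add: split_body_def)
  next
    case 2
    show ?case using AC by (simp add: Inv_def)
  next
    case (3 t s)
    show ?case
      using 3 by (intro body) (simp_all add: Inv_def env_def env frame_def split_body_def)
  next
    case (4 s)
    have "min C (A + b * d) = C"
      using AC d by simp
    with 4 show ?case
      by (simp add: Inv_def)
  qed
qed

lemma ed_base_ok: "computes_ed 0 ed_base"
  unfolding computes_ed_def
proof (intro conjI allI impI, goal_cases)
  case 1
  show ?case using writes_ed_prog[of 0] by simp
next
  case (2 st)
  define A C I J where vars: "A = reg st (rA 0)" "C = reg st (rC 0)" "I = reg st (rI 0)" "J = reg st (rJ 0)"
  have AC: "A \<le> C" "C \<le> n" "C - A \<le> 1" "I \<le> J" "J \<le> n"
    using 2 vars by simp_all
  \<comment> \<open>The value is lowered once an occurrence at a position at least \<open>t\<close>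
    has been seen.\<close>
  define Inv where "Inv t s \<longleftrightarrow> chr s 0 = (if A < n then Some (y ! A) else None) \<and>
     reg s (rV 0) = (if A < C \<and> (\<exists>p\<ge>t. I \<le> p \<and> p < J \<and> y ! p = y ! A) then J - I - 1
       else max (C - A) (J - I))"
    for t and s :: "'a state"
  have body: "ok (Query 1 (Reg (rN 0));;
        Cond (Conj (SameChar 0 1)
               (Conj (Less (Reg (rA 0)) (Reg (rC 0))) (Neg (Less (Reg (rN 0)) (Reg (rI 0))))))
          (rV 0 ::= Sub (Sub (Reg (rJ 0)) (Reg (rI 0))) (Num 1))
          Skip) s (Inv t)"
    if "reg s (rA 0) = A" "reg s (rC 0) = C" "reg s (rI 0) = I" "reg s (rJ 0) = J" "reg s (rN 0) = t"
      "t < J" and Inv: "Inv (Suc t) s" for t s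
  proof -
    have "(\<exists>p\<ge>t. I \<le> p \<and> p < J \<and> y ! p = y ! A) \<longleftrightarrow>
        I \<le> t \<and> y ! t = y ! A \<or> (\<exists>p\<ge>Suc t. I \<le> p \<and> p < J \<and> y ! p = y ! A)"
      using \<open>t < J\<close> by (metis Suc_leD Suc_leI le_neq_implies_less order_refl)
    then show ?thesis
      using that AC by (intro ok_Seq ok_Query ok_Cond ok_Assign ok_Skip) (auto simp: Inv_def length_y)
  qed
  have le: "max (C - A) (J - I) < U"
    using AC U_bounds by simp
  show ?case
    unfolding ed_base_def vars[symmetric]
    apply (intro ok_Seq ok_Assign ok_Query)
             apply (simp_all add: vars[symmetric] le[simplified] split del: if_split)
  proof (rule ok_countdown[where Inv = Inv], goal_cases)
    case 1
    show ?case by simp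
  next
    case 2
    show ?case by (auto simp: Inv_def length_y vars)
  next
    case (3 t s)
    then show ?case
      by (intro body[unfolded One_nat_def]) (simp_all add: Inv_def frame_def vars)
  next
    case (4 s)
    show ?case
    proof (cases "A < C")
      case True
      then have C: "C = Suc A" "A < length y"
        using AC length_y by auto
      have "y ! A \<in> set (sub y I J) \<longleftrightarrow> (\<exists>p. I \<le> p \<and> p < J \<and> y ! p = y ! A)"
        using set_sub[of J y I] AC length_y by force
      then show ?thesis
        using 4(1) C AC length_y by (simp add: Inv_def ed_singleton sub_Suc length_sub) blast
    next
      case False
      then show ?thesis
        using 4 AC length_y by (simp add: Inv_def ed_Nil length_sub)
    qed
  qed
qed

text \<open>Splitting a string of length at most \<open>b ^ Suc h\<close> gives \<open>b\<close>
  pieces of length at most \<open>b ^ h\<close> that concatenate to the string itself, so merging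
  them measures the distance of the string exactly.\<close>

lemma ed_prog_ok: "computes_ed h (ed_prog h)"
proof (induction h)
  case 0
  show ?case by (simp add: ed_base_ok)
next
  case (Suc h)
  show ?case
    unfolding computes_ed_def
  proof (intro conjI allI impI writes_ed_prog)
    fix st :: "'a state"
    assume st: "env st" "reg st (rA (Suc h)) \<le> reg st (rC (Suc h))" "reg st (rC (Suc h)) \<le> n"
      "reg st (rC (Suc h)) - reg st (rA (Suc h)) \<le> b ^ Suc h"
      "reg st (rI (Suc h)) \<le> reg st (rJ (Suc h))" "reg st (rJ (Suc h)) \<le> n"
    have "ok (split_prog (Suc h)) st (\<lambda>s. valid (Suc n) (b ^ h) b (reg s (rZ (Suc h))) \<and>
        pieces y (Suc n) b (reg s (rZ (Suc h))) = sub y (reg st (rA (Suc h))) (reg st (rC (Suc h))))"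
      using st by (intro split_prog_ok) simp_all
    then show "ok (ed_prog (Suc h)) st (\<lambda>s. reg s (rV (Suc h)) =
       ed (sub y (reg st (rA (Suc h))) (reg st (rC (Suc h)))) (sub y (reg st (rI (Suc h))) (reg st (rJ (Suc h)))))"
      unfolding ed_prog.simps
    proof (rule ok_Seq[OF ok_consequence], goal_cases)
      case (1 s)
      have "env s"
        using st(1) 1(2) by (rule env_frame) (simp add: writes_split_prog)
      moreover have "reg s (rI (Suc h)) = reg st (rI (Suc h))" "reg s (rJ (Suc h)) = reg st (rJ (Suc h))"
        using 1(2) by (simp_all add: frame_def writes_split_prog)
      ultimately show ?case
        using merge_prog_ok[OF Suc.IH, of s] 1(1) st by simp
    qed
  qed
qed

end

section \<open>The online levels\<close>

abbreviation "rL h \<equiv> rg (Suc h) 12"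
abbreviation "rR h \<equiv> rg (Suc h) 13"
abbreviation "oT h \<equiv> rg (Suc h) 14"
abbreviation "oZ h \<equiv> rg (Suc h) 15"
abbreviation "oN h \<equiv> rg (Suc h) 16"
abbreviation "oV h \<equiv> rg (Suc h) 17"

text \<open>
  Truncating the accumulated distance at \<open>n\<close> is harmless as \<open>ed s sbar \<le> n\<close>, and keeps the register
  short even if the number of levels is large compared to \<open>n\<close>.
\<close>

definition charge :: "nat \<Rightarrow> com" where
  "charge r =
     rD ::= Add (Reg rD) (Reg r);;
     Cond (Less (Reg rn) (Reg rD)) (rD ::= Reg rn) Skip"

text \<open>An occurrence of the letter replaces the block at cost 0; otherwise the empty interval
  chosen by \<open>level_base\<close> stays. Past the end of the stream, register 0 is empty and
  matches no position.\<close>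

definition search_prog :: com where
  "search_prog =
     oN 0 ::= Reg rn;;
     countdown (oN 0)
       (Query 1 (Reg (oN 0));;
        Cond (SameChar 0 1)
          (oV 0 ::= Num 0;; rL 0 ::= Reg (oN 0);; rR 0 ::= Add (Reg (oN 0)) (Num 1))
          Skip);;
     charge (oV 0)"

text \<open>
  The query at position \<open>n\<close> clears the character register 1, so that the comparison detects the end
  of the stream; blocks past the end are empty.
\<close>

definition level_base :: com where
  "level_base =
     Read 0;;
     rL 0 ::= Num 0;;
     rR 0 ::= Num 0;;
     Query 1 (Reg rn);;
     Cond (SameChar 0 1) (oV 0 ::= Num 0) (oV 0 ::= Num 1);;
     search_prog"

definition collect_prog :: "nat \<Rightarrow> com \<Rightarrow> com" where
  "collect_prog j p =
     oZ (Suc j) ::= Num 0;;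
     oT (Suc j) ::= Reg rb;;
     countdown (oT (Suc j))
       (p;;
        oZ (Suc j) ::= Add (Mul (Add (Mul (Reg (oZ (Suc j))) (Reg rM)) (Reg (rL j))) (Reg rM)) (Reg (rR j)))"

text \<open>The counter, below \<open>M * M\<close>, encodes a length and a right end. Truncated
  subtraction turns every value into a legitimate interval.\<close>

definition closest_body :: "nat \<Rightarrow> nat \<Rightarrow> com" where
  "closest_body k j =
     rJ (Suc k) ::= Mod (Reg (oN j)) (Reg rM);;
     rI (Suc k) ::= Sub (Reg (rJ (Suc k))) (Div (Reg (oN j)) (Reg rM));;
     merge_prog k (ed_prog k);;
     Cond (Less (Reg (rV (Suc k))) (Reg (oV j)))
       (oV j ::= Reg (rV (Suc k));; rL j ::= Reg (rI (Suc k));; rR j ::= Reg (rJ (Suc k)))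
       Skip"

text \<open>All online levels share the distance program of depth \<open>k\<close>: replacing
  substrings can be much longer than the blocks they stand for, but never longer than
  \<open>n \<le> b ^ k\<close>.\<close>

definition closest_prog :: "nat \<Rightarrow> nat \<Rightarrow> com" where
  "closest_prog k j =
     rZ (Suc k) ::= Reg (oZ j);;
     rL j ::= Num 0;;
     rR j ::= Num 0;;
     oV j ::= Add (Mul (Reg rb) (Reg rM)) (Reg rM);;
     oN j ::= Mul (Reg rM) (Reg rM);;
     countdown (oN j) (closest_body k j)"

fun level_prog :: "nat \<Rightarrow> nat \<Rightarrow> com" where
  "level_prog k 0 = level_base"
| "level_prog k (Suc j) =
     collect_prog j (level_prog k j);; closest_prog k (Suc j);; charge (oV (Suc j))"

definition level_regs :: "nat \<Rightarrow> nat set" where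
  "level_regs j = {rD} \<union> {rg (Suc g) f | g f. f < 12 \<or> g \<le> j \<and> f < 18}"

lemma rg_level_regs [simp]:
  "rg 0 f \<in> level_regs j \<longleftrightarrow> f = 2"
  "rg (Suc g) f \<in> level_regs j \<longleftrightarrow> f < 12 \<or> g \<le> j \<and> f < 18"
  by (auto simp: level_regs_def)

lemma writes_closest_prog:
  "writes (closest_prog k j) \<subseteq> {oZ j, rL j, rR j, oV j, oN j} \<union> {rg (Suc g) f | g f. f < 12}"
  using writes_ed_prog[of k]
  by (auto simp: closest_prog_def closest_body_def writes_merge_prog writes_match_prog scratch_def)

lemma writes_level_prog: "writes (level_prog k j) \<subseteq> level_regs j"
proof (induction j)
  case 0
  show ?case by (simp add: level_base_def search_prog_def charge_def)
next
  case (Suc j)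
  have "level_regs j \<subseteq> level_regs (Suc j)"
    by (auto simp: level_regs_def)
  moreover have "writes (closest_prog k (Suc j)) \<subseteq> level_regs (Suc j)"
    by (rule subset_trans[OF writes_closest_prog]) (auto simp: level_regs_def)
  ultimately show ?case
    using Suc by (simp add: collect_prog_def charge_def)
qed

lemma reads_closest_prog [simp]: "\<not> reads (closest_prog k j)"
  by (simp add: closest_prog_def closest_body_def merge_prog_def match_prog_def match_body_def)

section \<open>Correctness of the online levels\<close>

locale stream_space = ed_space P y U K n b for P :: com and y :: "'a list" and U K n b :: nat +
  fixes k :: nat
  assumes k_pos: "1 \<le> k"
    and n_le: "n \<le> b ^ k"
    and b_least: "\<And>c. 1 \<le> c \<Longrightarrow> n \<le> c ^ k \<Longrightarrow> b \<le> c"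
begin

lemma charge_ok:
  assumes "reg st rn = n" "reg st rD \<le> n" "reg st r \<le> b * n + b + n + 1" "r \<noteq> rD"
  shows "ok (charge r) st (\<lambda>s. reg s rD = min n (reg st rD + reg st r))"
  unfolding charge_def
  using assms U_bounds by (intro ok_Seq ok_Assign ok_Cond ok_Skip) auto

text \<open>The factors \<open>2 ^ Suc j - 1\<close> start at 1 and obey the recurrence
  \<open>2 * C + 1\<close> of \<open>approx_merge\<close>. The witness \<open>v\<close> is the
  untruncated amount charged for this block.\<close>

definition level_spec :: "nat \<Rightarrow> 'a state \<Rightarrow> 'a state \<Rightarrow> bool" where
  "level_spec j st s \<longleftrightarrow> reg s (rL j) \<le> reg s (rR j) \<and> reg s (rR j) \<le> n \<and>
     stream s = drop (b ^ j) (stream st) \<and>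
     (\<exists>v. approx y (2 ^ Suc j - 1) (take (b ^ j) (stream st)) (sub y (reg s (rL j)) (reg s (rR j))) v \<and>
        reg s rD = min n (reg st rD + v))"

lemma level_base_ok:
  assumes "env st" "reg st rD \<le> n"
  shows "ok level_base st (level_spec 0 st)"
proof -
  define x where "x = take 1 (stream st)"
  have x: "x = [] \<or> (\<exists>a. x = [a])"
    by (cases "stream st") (auto simp: x_def)
  define Inv where "Inv t s \<longleftrightarrow> stream s = drop 1 (stream st) \<and>
     chr s 0 = (case x of [] \<Rightarrow> None | a # _ \<Rightarrow> Some a) \<and>
     reg s (rL 0) \<le> reg s (rR 0) \<and> reg s (rR 0) \<le> n \<and> reg s (oV 0) \<le> 1 \<and>
     ed x (sub y (reg s (rL 0)) (reg s (rR 0))) \<le> reg s (oV 0) \<and>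
     (reg s (oV 0) = 0 \<or> (\<exists>a. x = [a] \<and> a \<notin> set (drop t y)))"
    for t and s :: "'a state"
  have body: "ok (Query 1 (Reg (oN 0));;
        Cond (SameChar 0 1)
          (oV 0 ::= Num 0;; rL 0 ::= Reg (oN 0);; rR 0 ::= Add (Reg (oN 0)) (Num 1))
          Skip) s (Inv t)"
    if N: "reg s (oN 0) = t" "t < n" and Inv: "Inv (Suc t) s" for t s
  proof (intro ok_Seq ok_Query ok_Cond ok_Assign ok_Skip, goal_cases)
    case 11
    then have "x = [y ! t]"
      using N Inv x length_y by (auto simp: Inv_def)
    then show ?case
      using N Inv length_y by (simp add: Inv_def sub_Suc)
  next
    case 12
    have "drop t y = y ! t # drop (Suc t) y"
      using N length_y by (simp add: Cons_nth_drop_Suc)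
    moreover have "y ! t \<noteq> a" if "x = [a]" for a
      using 12 that N Inv length_y by (auto simp: Inv_def)
    ultimately show ?case
      using Inv by (auto simp: Inv_def)
  qed (use N U_bounds in auto)
  have final: "ok (charge (oV 0)) s (level_spec 0 st)"
    if "Inv 0 s" "reg s rn = n" "reg s rD = reg st rD" for s
  proof (rule ok_consequence[OF charge_ok])
    fix s' assume s': "reg s' rD = min n (reg s rD + reg s (oV 0))" "frame (charge (oV 0)) s s'"
    \<comment> \<open>Cost 1 is charged only if the letter is absent from \<open>y\<close>, and then
      every substring is at distance at least 1.\<close>
    have "reg s (oV 0) \<le> ed x (sub y l r)" for l r
    proof (cases "reg s (oV 0) = 0")
      case False
      then obtain a where "x = [a]" "a \<notin> set y" "reg s (oV 0) = 1"
        using \<open>Inv 0 s\<close> by (auto simp: Inv_def)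
      then show ?thesis
        using set_sub_subset[of y l r] by (auto simp: ed_singleton)
    qed simp
    then have "approx y 1 x (sub y (reg s (rL 0)) (reg s (rR 0))) (reg s (oV 0))"
      using \<open>Inv 0 s\<close> by (simp add: approx_def Inv_def)
    then show "level_spec 0 st s'"
      using s' that unfolding level_spec_def
      by (auto simp: frame_def charge_def Inv_def x_def)
  qed (use that assms in \<open>auto simp: Inv_def\<close>)
  have rest: "ok search_prog s (level_spec 0 st)"
    if s: "Inv n s" "reg s rn = n" "reg s rD = reg st rD" for s
    unfolding search_prog_def
    apply (intro ok_Seq ok_Assign)
      apply (simp_all add: s)
  proof (rule ok_countdown[where Inv = Inv], goal_cases)
    case 2
    show ?case using s(1) by (simp add: Inv_def)
  next
    case (3 t s')
    then show ?case
      by (intro body[unfolded One_nat_def]) (simp_all add: Inv_def frame_def)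
  next
    case (4 s')
    then show ?case
      using s by (intro final) (simp_all add: frame_def)
  qed simp
  show ?thesis
    unfolding level_base_def
    apply (intro ok_Seq ok_Read ok_Assign ok_Query ok_Cond)
                   apply (simp_all add: U_gt_1 del: One_nat_def split del: if_split)
  proof (goal_cases)
    case 1
    then have "x = []"
      using assms(1) length_y by (cases "stream st") (auto simp: env_def x_def)
    show ?case
      by (rule rest) (use \<open>x = []\<close> assms in \<open>auto simp: Inv_def env_def x_def drop_Suc\<close>)
  next
    case 2
    then obtain a where "x = [a]"
      using assms(1) length_y by (cases "stream st") (auto simp: env_def x_def)
    show ?case
      by (rule rest) (use \<open>x = [a]\<close> assms in
        \<open>auto simp: Inv_def env_def x_def drop_Suc ed_singleton length_y split: list.splits\<close>)
  qed
qed

lemma collect_prog_ok: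
  assumes p: "\<And>st. env st \<Longrightarrow> reg st rD \<le> n \<Longrightarrow> ok p st (level_spec j st)"
    and W: "writes p \<subseteq> level_regs j"
    and st: "env st" "reg st rD \<le> n"
  shows "ok (collect_prog j p) st (\<lambda>s. valid (Suc n) (b ^ k) b (reg s (oZ (Suc j))) \<and>
    stream s = drop (b ^ Suc j) (stream st) \<and>
    (\<exists>v. approx y (2 ^ Suc j - 1) (take (b ^ Suc j) (stream st)) (pieces y (Suc n) b (reg s (oZ (Suc j)))) v \<and>
      reg s rD = min n (reg st rD + v)))"
proof -
  define c B str where cB: "c = 2 ^ Suc j - (1 :: nat)" "B = b ^ j" "str = stream st"
  define Inv where "Inv t s \<longleftrightarrow> reg s (oZ (Suc j)) < Suc n ^ (2 * (b - t)) \<and>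
     valid (Suc n) (b ^ k) (b - t) (reg s (oZ (Suc j))) \<and> stream s = drop ((b - t) * B) str \<and>
     (\<exists>v. approx y c (take ((b - t) * B) str) (pieces y (Suc n) (b - t) (reg s (oZ (Suc j)))) v \<and>
       reg s rD = min n (reg st rD + v))"
    for t and s :: "'a state"
  have nW: "rn \<notin> writes p" "rM \<notin> writes p" "rb \<notin> writes p" "rW \<notin> writes p"
      "oZ (Suc j) \<notin> writes p" "oT (Suc j) \<notin> writes p"
    using W by (auto dest!: subsetD)
  have body: "ok (p;; oZ (Suc j) ::= Add (Mul (Add (Mul (Reg (oZ (Suc j))) (Reg rM)) (Reg (rL j))) (Reg rM)) (Reg (rR j)))
      s (Inv t)"
    if s: "env s" "t < b" and Inv: "Inv (Suc t) s" for t s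
  proof (rule ok_Seq, rule ok_consequence[OF p])
    show "env s" by fact
    show "reg s rD \<le> n"
      using Inv by (auto simp: Inv_def)
  next
    fix s' assume spec: "level_spec j s s'" and F: "frame p s s'"
    define i where "i = b - Suc t"
    have i: "b - t = Suc i" "Suc i \<le> b"
      using s(2) by (auto simp: i_def)
    define Z l r where Zlr: "Z = reg s (oZ (Suc j))" "l = reg s' (rL j)" "r = reg s' (rR j)"
    obtain v where Inv': "Z < Suc n ^ (2 * i)" "valid (Suc n) (b ^ k) i Z" "stream s = drop (i * B) str"
        "approx y c (take (i * B) str) (pieces y (Suc n) i Z) v" "reg s rD = min n (reg st rD + v)"
      using Inv by (auto simp: Inv_def Zlr i_def)
    obtain v' where spec': "l \<le> r" "r \<le> n" "stream s' = drop B (stream s)"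
        "approx y c (take B (stream s)) (sub y l r) v'" "reg s' rD = min n (reg s rD + v')"
      using spec by (auto simp: level_spec_def Zlr cB)
    have lr: "l < Suc n" "r < Suc n"
      using spec' by auto
    let ?Z = "(Z * Suc n + l) * Suc n + r"
    have less: "?Z < Suc n ^ (2 * Suc i)"
      by (rule push_less[OF Inv'(1) lr])
    also have "\<dots> \<le> Suc n ^ (2 * b)"
      by (rule power_increasing) (use i in auto)
    finally have Z_U: "?Z < U"
      using U_power by simp
    have Z_U': "(Z * Suc n + l) * Suc n < U" "Z * Suc n + l < U" "Z * Suc n < U"
      using Z_U by simp_all
    have "take (Suc i * B) str = take (i * B) str @ take B (stream s)"
      using take_add[of "i * B" B str] Inv'(3) by (simp add: add.commute)
    then have "approx y c (take (Suc i * B) str) (pieces y (Suc n) (Suc i) ?Z) (v + v')"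
      unfolding pieces_push[OF lr] using approx_append[OF Inv'(4) spec'(4)] by simp
    moreover have "reg s' rD = min n (reg st rD + (v + v'))"
      using spec'(5) Inv'(5) by simp
    ultimately have ex: "\<exists>v. approx y c (take (Suc i * B) str) (pieces y (Suc n) (Suc i) ?Z) v \<and>
        reg s' rD = min n (reg st rD + v)"
      by blast
    have val: "valid (Suc n) (b ^ k) (Suc i) ?Z"
      unfolding valid_push[OF lr] using spec' Inv'(2) n_le by simp
    have str: "stream s' = drop (Suc i * B) str"
      using spec'(3) Inv'(3) by simp
    have regs: "reg s' rM = Suc n" "reg s' (oZ (Suc j)) = Z"
      using F s(1) by (simp_all add: frame_def nW env_def Zlr)
    show "ok (oZ (Suc j) ::= Add (Mul (Add (Mul (Reg (oZ (Suc j))) (Reg rM)) (Reg (rL j))) (Reg rM)) (Reg (rR j)))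
        s' (Inv t)"
      using less ex val str Z_U Z_U' unfolding Inv_def i
      by (intro ok_Assign) (simp_all add: regs Zlr(2,3)[symmetric]
        del: pieces.simps valid.simps mult_Suc_right mult_Suc power_Suc)
  qed
  note env = st(1)[unfolded env_def, simplified]
  show ?thesis
    unfolding collect_prog_def
    apply (intro ok_Seq ok_Assign)
         apply (simp_all add: env del: power_Suc)
  proof (rule ok_countdown[where Inv = Inv], goal_cases)
    case 1
    show ?case by (simp add: nW)
  next
    case 2
    show ?case using approx_Nil[of y c] st(2) by (auto simp: Inv_def cB intro!: exI[of _ 0])
  next
    case (3 t s)
    then show ?case
      by (intro body) (simp_all add: Inv_def env_def env frame_def nW)
  next
    case (4 s)
    then show ?case
      by (simp add: Inv_def cB mult.commute)
  qed
qed

lemma closest_prog_ok: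
  assumes "env st" and val: "valid (Suc n) (b ^ k) b (reg st (oZ j))"
  shows "ok (closest_prog k j) st (\<lambda>s. reg s (rL j) \<le> reg s (rR j) \<and> reg s (rR j) \<le> n \<and>
    reg s (oV j) \<le> b * n + b + n + 1 \<and>
    ed (pieces y (Suc n) b (reg st (oZ j))) (sub y (reg s (rL j)) (reg s (rR j))) \<le> reg s (oV j) \<and>
    (\<forall>l r. l \<le> r \<longrightarrow> r \<le> n \<longrightarrow> reg s (oV j) \<le> ed (pieces y (Suc n) b (reg st (oZ j))) (sub y l r)))"
proof -
  define Z w where Zw: "Z = reg st (oZ j)" "w = pieces y (Suc n) b Z"
  define Inv where "Inv t s \<longleftrightarrow> reg s (rL j) \<le> reg s (rR j) \<and> reg s (rR j) \<le> n \<and>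
    reg s (oV j) \<le> b * n + b + n + 1 \<and> ed w (sub y (reg s (rL j)) (reg s (rR j))) \<le> reg s (oV j) \<and>
    (\<forall>X. t \<le> X \<longrightarrow> X < Suc n * Suc n \<longrightarrow>
      reg s (oV j) \<le> ed w (sub y (X mod Suc n - X div Suc n) (X mod Suc n)))"
    for t and s :: "'a state"
  have nW: "rg 0 f \<notin> writes (merge_prog k (ed_prog k))"
     "12 \<le> f \<Longrightarrow> rg (Suc h) f \<notin> writes (merge_prog k (ed_prog k))"
     "rI (Suc k) \<notin> writes (merge_prog k (ed_prog k))"
     "rJ (Suc k) \<notin> writes (merge_prog k (ed_prog k))"
     "rZ (Suc k) \<notin> writes (merge_prog k (ed_prog k))" for f h
    using writes_ed_prog[of k] by (auto simp: writes_merge_prog writes_match_prog dest!: subsetD)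
  have body: "ok (closest_body k j) s (Inv t)"
    if s: "env s" "reg s (rZ (Suc k)) = Z" "reg s (oN j) = t" and Inv: "Inv (Suc t) s" for t s
  proof -
    define J I where IJ: "J = t mod Suc n" "I = J - t div Suc n"
    have IJ_le: "I \<le> J" "J \<le> n"
      using IJ mod_less_divisor[of "Suc n" t] by simp_all
    define s1 where "s1 = s\<lparr>reg := (reg s)(rJ (Suc k) := J, rI (Suc k) := I)\<rparr>"
    have "ok (merge_prog k (ed_prog k)) s1 (\<lambda>s'. reg s' (rV (Suc k)) = ed w (sub y I J))"
      using merge_prog_ok[OF ed_prog_ok, of s1 k] s IJ_le val
      by (simp add: s1_def env_def Zw)
    then have "ok (merge_prog k (ed_prog k)) s1 (\<lambda>s'. ok (Cond (Less (Reg (rV (Suc k))) (Reg (oV j)))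
       (oV j ::= Reg (rV (Suc k));; rL j ::= Reg (rI (Suc k));; rR j ::= Reg (rJ (Suc k))) Skip) s' (Inv t))"
    proof (rule ok_consequence)
      fix s' assume V: "reg s' (rV (Suc k)) = ed w (sub y I J)"
        and F: "frame (merge_prog k (ed_prog k)) s1 s'"
      have regs: "reg s' (rI (Suc k)) = I" "reg s' (rJ (Suc k)) = J" "reg s' (rL j) = reg s (rL j)"
          "reg s' (rR j) = reg s (rR j)" "reg s' (oV j) = reg s (oV j)"
        using F by (simp_all add: frame_def nW s1_def)
      have le: "reg s (oV j) \<le> ed w (sub y (X mod Suc n - X div Suc n) (X mod Suc n))"
        if "t \<le> X" "X \<noteq> t" "X < Suc n * Suc n" for X
        using Inv that by (simp add: Inv_def)
      show "ok (Cond (Less (Reg (rV (Suc k))) (Reg (oV j)))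
         (oV j ::= Reg (rV (Suc k));; rL j ::= Reg (rI (Suc k));; rR j ::= Reg (rJ (Suc k))) Skip) s' (Inv t)"
      proof (intro ok_Seq ok_Cond ok_Assign ok_Skip, goal_cases)
        case 9
        then have less: "ed w (sub y I J) < reg s (oV j)"
          using V regs by simp
        have "ed w (sub y I J) \<le> ed w (sub y (X mod Suc n - X div Suc n) (X mod Suc n))"
          if "t \<le> X" "X < Suc n * Suc n" for X
          using le[of X] that less by (cases "X = t") (auto simp: IJ)
        then show ?case
          using less Inv IJ_le by (simp add: Inv_def V regs)
      next
        case 10
        then have "reg s (oV j) \<le> ed w (sub y (X mod Suc n - X div Suc n) (X mod Suc n))"
          if "t \<le> X" "X < Suc n * Suc n" for X
          using le[of X] that V regs by (cases "X = t") (auto simp: IJ)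
        then show ?case
          using Inv by (simp add: Inv_def regs)
      qed simp_all
    qed
    then show ?thesis
      unfolding closest_body_def
      apply (intro ok_Seq ok_Assign)
      using s by (simp_all add: env_def s1_def IJ)
  qed
  have init: "b * Suc n + Suc n < U" "b * Suc n < U" "Suc n * Suc n < U"
    using U_bounds by simp_all
  \<comment> \<open>The search starts with the empty interval as candidate, whose distance the start
    value of \<open>oV\<close> must not underestimate.\<close>
  have w_le: "ed w [] \<le> b * n + n"
    using ed_le_cost[of 0 0 y "Suc n" b Z 0] cost_le[of 0 0 y "Suc n" b Z 0] length_y
    unfolding Zw(2) by simp
  note env = assms(1)[unfolded env_def, simplified]
  show ?thesis
    unfolding closest_prog_def Zw[symmetric]
    apply (intro ok_Seq ok_Assign)
                    apply (simp_all add: env init[simplified])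
  proof (rule ok_countdown[where Inv = Inv], goal_cases)
    case 1
    show ?case by (simp add: closest_body_def nW)
  next
    case 2
    show ?case using w_le by (simp add: Inv_def)
  next
    case (3 t s)
    then show ?case
      by (intro body) (simp_all add: Inv_def env_def env frame_def closest_body_def nW Zw)
  next
    case (4 s)
    have "reg s (oV j) \<le> ed w (sub y l r)" if "l \<le> r" "r \<le> n" for l r
    proof -
      \<comment> \<open>The code of the interval from \<open>l\<close> to \<open>r\<close>; decoding
        gives \<open>r - (r - l) = l\<close>.\<close>
      let ?X = "(r - l) * Suc n + r"
      have "?X mod Suc n = r" "?X div Suc n = r - l"
        using push_digits(3,4)[of r "Suc n" r "r - l"] that by simp_all
      moreover have "?X < Suc n * Suc n"
      proof -
        have "?X < Suc (r - l) * Suc n"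
          using that by simp
        also have "\<dots> \<le> Suc n * Suc n"
          using that by (intro mult_le_mono1) simp
        finally show ?thesis .
      qed
      ultimately show ?thesis
        using 4(1) that unfolding Inv_def by (metis diff_diff_cancel le0)
    qed
    then show ?case
      using 4(1) by (simp add: Inv_def Zw)
  qed
qed

lemma level_prog_ok: "env st \<Longrightarrow> reg st rD \<le> n \<Longrightarrow> ok (level_prog k j) st (level_spec j st)"
proof (induction j arbitrary: st)
  case 0
  then show ?case by (simp add: level_base_ok)
next
  case (Suc j)
  show ?case
    unfolding level_prog.simps
  proof (rule ok_Seq, rule ok_consequence[OF collect_prog_ok[OF Suc.IH writes_level_prog Suc.prems]])
    fix s :: "'a state"
    let ?Z = "reg s (oZ (Suc j))" and ?x = "take (b ^ Suc j) (stream st)"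
    assume s: "valid (Suc n) (b ^ k) b ?Z \<and> stream s = drop (b ^ Suc j) (stream st) \<and>
        (\<exists>v. approx y (2 ^ Suc j - 1) ?x (pieces y (Suc n) b ?Z) v \<and> reg s rD = min n (reg st rD + v))"
      and F: "frame (collect_prog j (level_prog k j)) st s"
    then obtain v where v: "approx y (2 ^ Suc j - 1) ?x (pieces y (Suc n) b ?Z) v"
        "reg s rD = min n (reg st rD + v)"
      by blast
    have W: "writes (collect_prog j (level_prog k j)) \<subseteq> level_regs (Suc j)"
      using writes_level_prog[of k "Suc j"] by simp
    have "rg 0 f \<notin> writes (collect_prog j (level_prog k j))" if "f \<noteq> 2" for f
      using subsetD[OF W, of "rg 0 f"] that by auto
    then have env: "env s"
      by (intro env_frame[OF Suc.prems(1) F]) simp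
    show "ok (closest_prog k (Suc j);; charge (oV (Suc j))) s (level_spec (Suc j) st)"
    proof (rule ok_Seq, rule ok_consequence[OF closest_prog_ok[OF env]], goal_cases)
      case (2 s2)
      define L R V where LRV: "L = reg s2 (rL (Suc j))" "R = reg s2 (rR (Suc j))" "V = reg s2 (oV (Suc j))"
      note 2 = 2[folded LRV]
      have "rg 0 f \<notin> writes (closest_prog k (Suc j))" for f
        using subsetD[OF writes_closest_prog[of k "Suc j"], of "rg 0 f"] by auto
      then have s2: "stream s2 = stream s" "reg s2 rD = reg s rD" "reg s2 rn = n"
        using 2(2) env by (auto simp: frame_def env_def)
      have "approx y (2 * (2 ^ Suc j - 1) + 1) ?x (sub y L R) (v + V)"
        by (rule approx_merge[OF v(1)]) (use 2 length_y in auto)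
      moreover have "2 * (2 ^ Suc j - 1) + 1 = 2 ^ Suc (Suc j) - (1 :: nat)"
        using one_le_power[of "2 :: nat" "Suc j"] unfolding power_Suc by arith
      ultimately have *: "approx y (2 ^ Suc (Suc j) - 1) ?x (sub y L R) (v + V)"
        by simp
      show ?case
      proof (rule ok_consequence[OF charge_ok])
        fix s3 assume s3: "reg s3 rD = min n (reg s2 rD + reg s2 (oV (Suc j)))"
            "frame (charge (oV (Suc j))) s2 s3"
        have "reg s3 (rL (Suc j)) = L" "reg s3 (rR (Suc j)) = R" "stream s3 = stream s2"
          using s3(2) by (simp_all add: frame_def charge_def LRV)
        moreover have "reg s3 rD = min n (reg st rD + (v + V))"
          using s3(1) s2 v(2) LRV by simp
        ultimately show "level_spec (Suc j) st s3"
          unfolding level_spec_def using 2(1) * s s2 by auto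
      qed (use 2 s2 v LRV in auto)
    qed (use s in simp)
  qed
qed

end

section \<open>The complete algorithm\<close>

text \<open>
  The power is computed by \<open>i\<close> copies of the loop body, because a register counting up to \<open>i\<close>
  would be too long if the input is much shorter than \<open>i\<close>. For the same reason it is truncated.
\<close>

fun power_prog :: "nat \<Rightarrow> com" where
  "power_prog 0 = Skip"
| "power_prog (Suc i) =
     Cond (Less (Reg rp) (Reg rn)) (rp ::= Mul (Reg rp) (Add (Reg rt) (Num 1))) Skip;; power_prog i"

text \<open>The candidates \<open>t + 1\<close> run from \<open>n\<close> down to 1, so the last
  success is the least root. For \<open>n = 0\<close> the loop is void and the start value 1 is the
  answer.\<close>

definition root_prog :: "nat \<Rightarrow> com" where
  "root_prog k =
     rb ::= Add (Reg rn) (Num 1);;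
     rt ::= Reg rn;;
     countdown rt
       (rp ::= Num 1;;
        power_prog k;;
        Cond (Less (Reg rp) (Reg rn)) Skip (rb ::= Add (Reg rt) (Num 1)))"

definition init_prog :: "nat \<Rightarrow> com" where
  "init_prog k =
     root_prog k;;
     rM ::= Add (Reg rn) (Num 1);;
     rW ::= Num 1;;
     rt ::= Reg rb;;
     countdown rt (rW ::= Mul (Reg rW) (Reg rM))"

definition final_prog :: "nat \<Rightarrow> com" where
  "final_prog k =
     rA k ::= Reg (rL k);;
     rC k ::= Reg (rR k);;
     rI k ::= Num 0;;
     rJ k ::= Reg rn;;
     ed_prog k;;
     charge (rV k);;
     rn ::= Reg rD"

definition main_prog :: "nat \<Rightarrow> com" where
  "main_prog k = init_prog k;; level_prog k k;; final_prog k"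

lemma writes_power_prog: "writes (power_prog i) \<subseteq> {rp}"
  by (induction i) auto

lemma reads_power_prog [simp]: "\<not> reads (power_prog i)"
  by (induction i) auto

lemma frame_power_prog: "frame (power_prog i) s s' \<Longrightarrow> r \<noteq> rp \<Longrightarrow> reg s' r = reg s r"
  using writes_power_prog[of i] by (auto simp: frame_def)

lemma notin_writes_power_prog: "r \<noteq> rp \<Longrightarrow> r \<notin> writes (power_prog i)"
  using writes_power_prog[of i] by auto

section \<open>Correctness of the complete algorithm\<close>

context stream_space
begin

text \<open>Multiplication stops once the product reaches \<open>n\<close>. The omitted factors are
  positive, so the comparison with \<open>n\<close> has the same outcome as for the full
  power.\<close>

lemma power_prog_ok:
  "reg st rn = n \<Longrightarrow> reg st rt < n \<Longrightarrow>
   ok (power_prog i) st (\<lambda>s. n \<le> reg s rp \<longleftrightarrow> n \<le> reg st rp * Suc (reg st rt) ^ i)"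
proof (induction i arbitrary: st)
  case 0
  then show ?case by (auto intro: ok_Skip)
next
  case (Suc i)
  show ?case
    unfolding power_prog.simps
  proof (intro ok_Seq ok_Cond ok_Assign ok_Skip, goal_cases)
    case 4
    then have "reg st rp * Suc (reg st rt) \<le> n * n"
      using Suc.prems by (intro mult_le_mono) simp_all
    also have "n * n < U"
      using U_bounds(2) by (simp add: algebra_simps)
    finally show ?case
      using Suc.prems U_bounds by simp
  next
    case 5
    then show ?case
      using Suc.IH[of "st\<lparr>reg := (reg st)(rp := reg st rp * Suc (reg st rt))\<rparr>"] Suc.prems
      by (simp add: algebra_simps)
  next
    case 6
    then have "n \<le> reg st rp"
      using Suc.prems by simp
    then have "n \<le> reg st rp * Suc (reg st rt) ^ i" for i
      using mult_le_mono[of n "reg st rp" 1 "Suc (reg st rt) ^ i"] by simp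
    then show ?case
      using Suc.IH[of st] Suc.prems by (simp del: power_Suc)
  qed simp_all
qed

lemma root_prog_ok:
  assumes st: "reg st rn = n"
  shows "ok (root_prog k) st (\<lambda>s. reg s rb = b)"
proof -
  define Inv where "Inv t s \<longleftrightarrow> 1 \<le> reg s rb \<and> reg s rb \<le> n + 1 \<and> n \<le> reg s rb ^ k \<and>
     (\<forall>c\<ge>Suc t. c \<le> n \<longrightarrow> n \<le> c ^ k \<longrightarrow> reg s rb \<le> c)"
    for t and s :: "'a state"
  have body: "ok (rp ::= Num 1;; power_prog k;;
        Cond (Less (Reg rp) (Reg rn)) Skip (rb ::= Add (Reg rt) (Num 1))) s (Inv t)"
    if s: "reg s rn = n" "reg s rt = t" "t < n" and Inv: "Inv (Suc t) s" for s t
  proof (intro ok_Seq ok_Assign, goal_cases)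
    case 3
    let ?s = "s\<lparr>reg := (reg s)(rp := 1)\<rparr>"
    have "ok (power_prog k) ?s (\<lambda>s'. n \<le> reg s' rp \<longleftrightarrow> n \<le> Suc t ^ k)"
      using power_prog_ok[of ?s k] s by simp
    then have "ok (power_prog k) ?s
        (\<lambda>s'. ok (Cond (Less (Reg rp) (Reg rn)) Skip (rb ::= Add (Reg rt) (Num 1))) s' (Inv t))"
    proof (rule ok_consequence)
      fix s' assume p: "n \<le> reg s' rp \<longleftrightarrow> n \<le> Suc t ^ k" and "frame (power_prog k) ?s s'"
      from frame_power_prog[OF this(2)] have regs: "reg s' rn = n" "reg s' rt = t" "reg s' rb = reg s rb"
        using s by simp_all
      have le: "reg s rb \<le> c" if "Suc t \<le> c" "c \<noteq> Suc t" "c \<le> n" "n \<le> c ^ k" for c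
        using Inv that by (simp add: Inv_def)
      show "ok (Cond (Less (Reg rp) (Reg rn)) Skip (rb ::= Add (Reg rt) (Num 1))) s' (Inv t)"
      proof (intro ok_Cond ok_Skip ok_Assign, goal_cases)
        case 3
        then have "reg s rb \<le> c" if "Suc t \<le> c" "c \<le> n" "n \<le> c ^ k" for c
          using le[of c] that p regs by (cases "c = Suc t") auto
        then show ?case
          using Inv by (simp add: Inv_def regs)
      qed (use s p regs U_bounds in \<open>auto simp: Inv_def\<close>)
    qed
    then show ?case by simp
  qed simp_all
  have "n + 1 \<le> (n + 1) ^ k"
    using power_increasing[of 1 k "n + 1"] k_pos by simp
  then have init: "n \<le> (n + 1) ^ k"
    by simp
  show ?thesis
    unfolding root_prog_def
    apply (intro ok_Seq ok_Assign)
        apply (use U_bounds in \<open>simp_all add: st\<close>)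
  proof (rule ok_countdown[where Inv = Inv], goal_cases)
    case 1
    show ?case by (simp add: notin_writes_power_prog)
  next
    case 2
    show ?case using init by (simp add: Inv_def)
  next
    case (3 t s)
    then show ?case
      by (intro body[simplified]) (simp_all add: Inv_def frame_def notin_writes_power_prog st)
  next
    case (4 s)
    then have "b \<le> reg s rb"
      by (intro b_least) (auto simp: Inv_def)
    moreover have "reg s rb \<le> b"
      using 4 n_le b_pos by (cases "b \<le> n") (auto simp: Inv_def)
    ultimately show ?case by simp
  qed
qed

lemma init_prog_ok:
  assumes st: "reg st rn = n"
  shows "ok (init_prog k) st env"
  unfolding init_prog_def
proof (rule ok_Seq, rule ok_consequence[OF root_prog_ok[OF st]])
  fix s assume b: "reg s rb = b" and "frame (root_prog k) st s"
  then have n: "reg s rn = n"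
    using st by (simp add: frame_def root_prog_def notin_writes_power_prog)
  define Inv where "Inv t s \<longleftrightarrow> reg s rW = Suc n ^ (b - t)"
    for t and s :: "'a state"
  show "ok (rM ::= Add (Reg rn) (Num 1);; rW ::= Num 1;; rt ::= Reg rb;;
     countdown rt (rW ::= Mul (Reg rW) (Reg rM))) s env"
    apply (intro ok_Seq ok_Assign)
           apply (use U_bounds in \<open>simp_all add: b n\<close>)
  proof (rule ok_countdown[where Inv = Inv], goal_cases)
    case 2
    show ?case by (simp add: Inv_def)
  next
    case (3 t s')
    have t: "b - t = Suc (b - Suc t)"
      using 3 by simp
    have "Suc n ^ Suc (b - Suc t) \<le> Suc n ^ (2 * b)"
      using 3 by (intro power_increasing) simp_all
    also have "\<dots> < U"
      using U_power by simp
    finally have "reg s' rW * Suc n < U"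
      using 3 by (simp add: Inv_def mult.commute)
    with 3 show ?case
      by (intro ok_Assign) (simp_all add: Inv_def frame_def t)
  next
    case (4 s')
    then show ?case
      by (simp add: Inv_def env_def frame_def b n)
  qed simp
qed

lemma main_prog_ok:
  assumes "length s = n"
  shows "ok (main_prog k) (initial_state n s)
    (\<lambda>s'. ed s y \<le> reg s' 0 \<and> reg s' 0 \<le> 2 ^ (k + 2) * ed s y)"
  unfolding main_prog_def
proof (rule ok_Seq, rule ok_consequence[OF init_prog_ok])
  show "reg (initial_state n s) rn = n"
    by (simp add: initial_state_def rg_0)
  fix s1 :: "'a state"
  assume env1: "env s1" and F1: "frame (init_prog k) (initial_state n s) s1"
  have D1: "reg s1 rD = 0" and str1: "stream s1 = s"
    using F1 rg_eq[of 0 2 0 0]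
    by (simp_all add: frame_def init_prog_def root_prog_def initial_state_def notin_writes_power_prog rg_0)
  show "ok (level_prog k k;; final_prog k) s1
     (\<lambda>s'. ed s y \<le> reg s' 0 \<and> reg s' 0 \<le> 2 ^ (k + 2) * ed s y)"
  proof (rule ok_Seq, rule ok_consequence[OF level_prog_ok[OF env1]])
    show "reg s1 rD \<le> n"
      using D1 by simp
    fix s2 assume s2: "level_spec k s1 s2" and F2: "frame (level_prog k k) s1 s2"
    have "rg 0 f \<notin> writes (level_prog k k)" if "f \<noteq> 2" for f
      using subsetD[OF writes_level_prog[of k k], of "rg 0 f"] that by auto
    then have env2: "env s2"
      by (intro env_frame[OF env1 F2]) simp
    define L R where LR: "L = reg s2 (rL k)" "R = reg s2 (rR k)"
    define V where "V = ed (sub y L R) y"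
    have LR_le: "L \<le> R" "R \<le> n"
      using s2 by (auto simp: level_spec_def LR)
    \<comment> \<open>A single block of level \<open>k\<close> covers the whole stream.\<close>
    have "take (b ^ k) s = s"
      using assms n_le by simp
    then obtain v where v: "approx y (2 ^ Suc k - 1) s (sub y L R) v" "reg s2 rD = min n v"
      using s2 by (auto simp: level_spec_def LR D1 str1)
    have "V \<le> n"
      using ed_sub_le[of y L R 0 n] sub_all[of y] length_y by (simp add: V_def)
    have "ed s y \<le> n"
      using ed_le_max[of s y] assms length_y by simp
    moreover have s_le: "ed s (sub y L R) \<le> v"
      using v(1) by (simp add: approx_def)
    then have "ed s y \<le> v + V"
      using ed_triangle[of s y "sub y L R"] by (simp add: V_def)
    ultimately have lower: "ed s y \<le> min n (v + V)"
      by simp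
    have "v \<le> (2 ^ Suc k - 1) * ed s (sub y 0 n)"
      using v(1) length_y unfolding approx_def by blast
    then have v_le: "v \<le> (2 ^ Suc k - 1) * ed s y"
      using sub_all[of y] length_y by simp
    \<comment> \<open>The final distance to \<open>y\<close> acts like one more merge, which brings
      the factor to \<open>2 ^ (k + 2) - 1\<close>.\<close>
    have "V \<le> v + ed s y"
      using ed_triangle[of "sub y L R" y s] s_le by (simp add: V_def ed_sym[of _ s])
    then have "v + V \<le> 2 * ((2 ^ Suc k - 1) * ed s y) + ed s y"
      using v_le by simp
    also have "\<dots> = (2 * (2 ^ Suc k - 1) + 1) * ed s y"
      by (simp only: distrib_right mult_1 mult.assoc)
    also have "\<dots> \<le> 2 ^ (k + 2) * ed s y"
    proof (rule mult_le_mono1)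
      have "2 * (2 * m - 1) + 1 \<le> 4 * m" if "1 \<le> m" for m :: nat
        using that by simp
      from this[of "2 ^ k"] show "2 * (2 ^ Suc k - 1) + 1 \<le> (2 :: nat) ^ (k + 2)"
        by simp
    qed
    finally have upper: "min n (v + V) \<le> 2 ^ (k + 2) * ed s y"
      by simp
    define s3 where "s3 = s2\<lparr>reg := (reg s2)(rA k := L, rC k := R, rI k := 0, rJ k := n)\<rparr>"
    have regs3: "reg s3 (rA k) = L" "reg s3 (rC k) = R" "reg s3 (rI k) = 0" "reg s3 (rJ k) = n"
        "env s3" "reg s3 rD = min n v"
      using env2 v(2) by (simp_all add: s3_def env_def)
    have "ok (ed_prog k) s3 (\<lambda>s'. reg s' (rV k) = V)"
      using ed_prog_ok[of k, unfolded computes_ed_def, THEN conjunct2, rule_format, of s3]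
        LR_le n_le sub_all[of y] length_y
      by (simp add: regs3 V_def)
    then have "ok (ed_prog k) s3 (\<lambda>s'. ok (charge (rV k);; rn ::= Reg rD) s'
        (\<lambda>s'. ed s y \<le> reg s' 0 \<and> reg s' 0 \<le> 2 ^ (k + 2) * ed s y))"
    proof (rule ok_consequence)
      fix s4 assume V4: "reg s4 (rV k) = V" and F4: "frame (ed_prog k) s3 s4"
      have "rg 0 f \<notin> writes (ed_prog k)" for f
        using subsetD[OF writes_ed_prog[of k], of "rg 0 f"] by auto
      then have regs4: "reg s4 rn = n" "reg s4 rD = min n v"
        using F4 regs3 by (simp_all add: frame_def env_def)
      show "ok (charge (rV k);; rn ::= Reg rD) s4
        (\<lambda>s'. ed s y \<le> reg s' 0 \<and> reg s' 0 \<le> 2 ^ (k + 2) * ed s y)"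
      proof (rule ok_Seq, rule ok_consequence[OF charge_ok])
        fix s5 :: "'a state" assume "reg s5 rD = min n (reg s4 rD + reg s4 (rV k))"
        then have "reg s5 rD = min n (v + V)"
          using regs4 V4 by simp
        then show "ok (rn ::= Reg rD) s5
          (\<lambda>s'. ed s y \<le> reg s' 0 \<and> reg s' 0 \<le> 2 ^ (k + 2) * ed s y)"
          using lower upper by (intro ok_Assign) (simp_all add: rg_0)
      qed (use regs4 V4 \<open>V \<le> n\<close> in simp_all)
    qed
    then show "ok (final_prog k) s2
     (\<lambda>s'. ed s y \<le> reg s' 0 \<and> reg s' 0 \<le> 2 ^ (k + 2) * ed s y)"
      unfolding final_prog_def
      apply (intro ok_Seq[of "_ ::= _"] ok_Assign)
      using env2 by (simp_all add: s3_def env_def LR ok_Seq)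
  qed
qed

end

section \<open>Counting the registers\<close>

definition all_regs :: "nat \<Rightarrow> nat set" where
  "all_regs m = {rg g f | g f. g < m \<and> f < 18}"

lemma rg_all_regs [simp]: "rg g f \<in> all_regs m \<longleftrightarrow> g < m \<and> f < 18"
  by (auto simp: all_regs_def)

lemma all_regs_mono: "m \<le> m' \<Longrightarrow> all_regs m \<subseteq> all_regs m'"
  by (auto simp: all_regs_def)

lemma card_all_regs: "finite (all_regs m)" "card (all_regs m) \<le> 18 * m"
proof -
  have *: "all_regs m = case_prod rg ` ({..<m} \<times> {..<18})"
    by (auto simp: all_regs_def)
  show "finite (all_regs m)"
    unfolding * by simp
  show "card (all_regs m) \<le> 18 * m"
    unfolding * using card_image_le[of "{..<m} \<times> {..<18 :: nat}" "case_prod rg"] by simp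
qed

lemma regs_merge_prog:
  "regs e \<subseteq> all_regs (k + 2) \<Longrightarrow> regs (merge_prog k e) \<subseteq> all_regs (k + 3)"
  using all_regs_mono[of "k + 2" "k + 3"]
  by (auto simp: merge_prog_def match_prog_def match_body_def)

lemma regs_ed_prog: "regs (ed_prog h) \<subseteq> all_regs (h + 2)"
proof (induction h)
  case 0
  show ?case by (simp add: ed_base_def)
next
  case (Suc h)
  from regs_merge_prog[OF this] show ?case
    by (simp add: split_prog_def split_body_def numeral_3_eq_3)
qed

lemma regs_level_prog: "j \<le> k \<Longrightarrow> regs (level_prog k j) \<subseteq> all_regs (k + 3)"
proof (induction j)
  case 0
  show ?case by (simp add: level_base_def search_prog_def charge_def)
next
  case (Suc j)
  then show ?case
    using regs_merge_prog[OF regs_ed_prog[of k]]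
    by (simp add: collect_prog_def closest_prog_def closest_body_def charge_def)
qed

lemma regs_power_prog: "regs (power_prog i) \<subseteq> {rp, rn, rt}"
  by (induction i) auto

lemma regs_main_prog: "regs (main_prog k) \<subseteq> all_regs (k + 3)"
  using regs_level_prog[of k k] regs_ed_prog[of k] all_regs_mono[of "k + 2" "k + 3"]
    subset_trans[OF regs_power_prog[of k], of "all_regs (k + 3)"]
  by (simp add: main_prog_def init_prog_def root_prog_def final_prog_def charge_def)

lemma chrs_ed_prog: "chrs (ed_prog h) \<subseteq> {0, 1}"
  by (induction h)
    (auto simp: ed_base_def split_prog_def split_body_def merge_prog_def match_prog_def match_body_def)

lemma chrs_level_prog: "chrs (level_prog k j) \<subseteq> {0, 1}"
  using chrs_ed_prog[of k]
  by (induction j)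
    (auto simp: level_base_def search_prog_def charge_def collect_prog_def closest_prog_def closest_body_def
      merge_prog_def match_prog_def match_body_def)

lemma chrs_main_prog: "chrs (main_prog k) \<subseteq> {0, 1}"
proof -
  have "chrs (power_prog i) = {}" for i
    by (induction i) auto
  then show ?thesis
    using chrs_level_prog[of k k] chrs_ed_prog[of k]
    by (auto simp: main_prog_def init_prog_def root_prog_def final_prog_def charge_def)
qed

section \<open>Quantitative bounds\<close>

lemma half_le_ln_2: "1 / 2 \<le> ln (2 :: real)"
  using ln_le_minus_one[of "1 / 2 :: real"] by (simp add: ln_div)

text \<open>For \<delta> at most 1, \<open>k\<close> is at most twice 1/\<delta>, and
  \<open>1 / k\<close> is at most \<delta>. For larger \<delta>, \<open>k = 1\<close> and the
  division by \<delta> must be compensated: half of \<delta> is at most 2, and hence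
  \<open>n\<close>, to the power \<delta> - 1.\<close>

lemma levels_times_root_le:
  fixes \<delta> :: real
  assumes "0 < \<delta>" "2 \<le> n" "k = nat \<lceil>1 / \<delta>\<rceil>"
  shows "real k * real n powr (1 / real k) \<le> 2 * (real n powr \<delta> / \<delta>)"
proof (cases "\<delta> \<le> 1")
  case True
  have k: "1 / \<delta> \<le> real k" "real k \<le> 1 / \<delta> + 1"
    using assms(1,3) by (simp_all add: real_nat_ceiling_ge)
  have "1 \<le> 1 / \<delta>"
    using True assms(1) by simp
  then have k2: "real k \<le> 2 * (1 / \<delta>)" "0 < real k"
    using k by linarith+
  have "1 / real k \<le> \<delta>"
    using k(1) k2(2) assms(1) by (simp add: field_simps)
  then have "real n powr (1 / real k) \<le> real n powr \<delta>"
    using assms(2) by (intro powr_mono) auto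
  then have "real k * real n powr (1 / real k) \<le> (2 * (1 / \<delta>)) * real n powr \<delta>"
    using k2 assms(1) by (intro mult_mono) auto
  then show ?thesis by simp
next
  case False
  then have "1 / \<delta> \<le> 1" "0 < 1 / \<delta>"
    by simp_all
  then have "\<lceil>1 / \<delta>\<rceil> = 1"
    by (intro ceiling_unique) auto
  then have k: "k = 1"
    using assms(3) by simp
  have "\<delta> / 2 \<le> 1 + (\<delta> - 1) * (1 / 2)"
    by (simp add: field_simps)
  also have "\<dots> \<le> 1 + (\<delta> - 1) * ln 2"
    using False half_le_ln_2 by (intro add_left_mono mult_left_mono) auto
  also have "\<dots> \<le> 2 powr (\<delta> - 1)"
    using exp_ge_add_one_self[of "(\<delta> - 1) * ln 2"] by (simp add: powr_def)
  also have "\<dots> \<le> real n powr (\<delta> - 1)"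
    using False assms(2) by (intro powr_mono2) auto
  finally have "real n * (\<delta> / 2) \<le> real n * real n powr (\<delta> - 1)"
    by (intro mult_left_mono) auto
  also have "\<dots> = real n powr \<delta>"
    using assms(2) powr_add[of "real n" 1 "\<delta> - 1"] by simp
  finally show ?thesis
    using k False assms(2) by (simp add: field_simps)
qed

text \<open>For \<open>b > 1\<close>, minimality gives \<open>(b - 1) ^ k < n\<close>. Passing from
  \<open>b - 1\<close> to \<open>b\<close> at most adds the root once more, as the root is at least
  1.\<close>

lemma least_root_le:
  assumes "1 \<le> k" "2 \<le> n" "\<And>c. 1 \<le> c \<Longrightarrow> n \<le> c ^ k \<Longrightarrow> b \<le> c"
  shows "real b \<le> 2 * real n powr (1 / real k)"
proof -
  have one: "1 \<le> real n powr (1 / real k)"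
    using assms(1,2) by (intro ge_one_powr_ge_zero) auto
  show ?thesis
  proof (cases "b \<le> 1")
    case False
    have "(b - 1) ^ k < n"
    proof (rule ccontr)
      assume "\<not> (b - 1) ^ k < n"
      then show False
        using assms(3)[of "b - 1"] False by linarith
    qed
    then have "real (b - 1) ^ k \<le> real n"
      by (metis less_imp_le of_nat_le_iff of_nat_power)
    then have "(real (b - 1) ^ k) powr (1 / real k) \<le> real n powr (1 / real k)"
      by (intro powr_mono2) auto
    moreover have "(real (b - 1) ^ k) powr (1 / real k) = real (b - 1)"
      using False assms(1) by (simp add: powr_realpow[symmetric] powr_powr)
    ultimately show ?thesis
      using one False by (simp add: of_nat_diff)
  qed (use one in simp)
qed

lemma bits_power_le:
  assumes "2 \<le> n" "1 \<le> b"
  shows "real (bits ((n + 2) ^ (2 * b + 6))) \<le> 17 * real b * log 2 (real n)"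
proof -
  let ?U = "(n + 2) ^ (2 * b + 6)"
  have lg: "1 \<le> log 2 (real n)"
    using assms(1) by simp
  have floor_log_le: "real (floor_log u) \<le> log 2 (real u)" if "0 < u" for u
  proof -
    have "2 ^ floor_log u \<le> real u"
      using of_nat_mono[OF floor_log_exp2_le[OF that], where 'a = real] by simp
    then show ?thesis
      by (rule le_log_of_power) simp
  qed
  have "real (floor_log ?U) \<le> log 2 (real ?U)"
    by (rule floor_log_le) simp
  also have "\<dots> = real (2 * b + 6) * log 2 (real n + 2)"
    by (simp add: log_nat_power add.commute)
  \<comment> \<open>Here \<open>2 * b + 6 \<le> 8 * b\<close> and \<open>n + 2 \<le> n ^ 2\<close>.
    The extra bit in \<open>bits\<close> raises 16 to 17.\<close>
  also have "\<dots> \<le> (8 * real b) * (2 * log 2 (real n))"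
  proof (rule mult_mono)
    have "n + 2 \<le> n * n"
      using assms(1) mult_le_mono1[of 2 n n] by linarith
    then have "real n + 2 \<le> real n ^ 2"
      unfolding power2_eq_square by (metis of_nat_add of_nat_le_iff of_nat_mult of_nat_numeral)
    then have "log 2 (real n + 2) \<le> log 2 (real n ^ 2)"
      using assms(1) by simp
    then show "log 2 (real n + 2) \<le> 2 * log 2 (real n)"
      using assms(1) by (simp add: log_nat_power)
  qed (use assms(2) in auto)
  finally have "real (bits ?U) \<le> 1 + 16 * (real b * log 2 (real n))"
    by (simp add: bits_def)
  moreover have "1 * 1 \<le> real b * log 2 (real n)"
    using assms(2) lg by (intro mult_mono) auto
  ultimately show ?thesis
    by simp
qed

theorem theorem1:
  shows "\<exists>(A :: real) (B :: real) (c :: nat). \<forall>\<delta> :: real. \<delta> > 0 \<longrightarrow>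
    (\<exists>P :: com. \<forall>(n :: nat) (s :: nat list) (sbar :: nat list).
      length s = n \<and> length sbar = n \<longrightarrow>
      (\<exists>(D :: nat) (m :: nat).
         computes P sbar s D m \<and>
         ed s sbar \<le> D \<and>
         real D \<le> A * 2 powr (1 / \<delta>) * real (ed s sbar) \<and>
         (n \<ge> 2 \<longrightarrow> real m \<le> B * (real n powr \<delta> / \<delta>) * log 2 (real n) ^ c)))"
proof (rule exI[of _ 8], rule exI[of _ 6392], rule exI[of _ 1], intro allI impI)
  fix \<delta> :: real assume \<delta>: "\<delta> > 0"
  define k where "k = nat \<lceil>1 / \<delta>\<rceil>"
  have k: "1 \<le> k" "real k \<le> 1 / \<delta> + 1"
  proof -
    have "0 < \<lceil>1 / \<delta>\<rceil>"
      using \<delta> by simp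
    then show "1 \<le> k" "real k \<le> 1 / \<delta> + 1"
      unfolding k_def by linarith+
  qed
  show "\<exists>P. \<forall>n (s :: nat list) (sbar :: nat list). length s = n \<and> length sbar = n \<longrightarrow>
      (\<exists>D m. computes P sbar s D m \<and> ed s sbar \<le> D \<and>
         real D \<le> 8 * 2 powr (1 / \<delta>) * real (ed s sbar) \<and>
         (n \<ge> 2 \<longrightarrow> real m \<le> 6392 * (real n powr \<delta> / \<delta>) * log 2 (real n) ^ 1))"
  proof (intro exI[of _ "main_prog k"] allI impI)
    fix n and s y :: "nat list" assume len: "length s = n \<and> length y = n"
    \<comment> \<open>The conjunct \<open>1 \<le> c\<close> matters for \<open>n = 0\<close>, where
      the least root would be 0.\<close>
    define b where "b = (LEAST c. 1 \<le> c \<and> n \<le> c ^ k)"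
    have "n \<le> Suc n ^ k"
      using power_increasing[of 1 k "Suc n"] k(1) by simp
    then have "1 \<le> Suc n \<and> n \<le> Suc n ^ k"
      by simp
    then have b: "1 \<le> b" "n \<le> b ^ k"
      unfolding b_def using LeastI[of "\<lambda>c. 1 \<le> c \<and> n \<le> c ^ k" "Suc n"] by blast+
    have b_least: "b \<le> c" if "1 \<le> c" "n \<le> c ^ k" for c
      unfolding b_def using that by (intro Least_le) simp
    define U where "U = (n + 2) ^ (2 * b + 6)"
    \<comment> \<open>There are 18 registers for each of \<open>k + 3\<close> first indices, room
      for an expression of size 20, and two character cells.\<close>
    define K where "K = (18 * (k + 3) + 20) * bits U + 2"
    have U: "n + 2 \<le> U"
      unfolding U_def using power_increasing[of 1 "2 * b + 6" "n + 2"] by simp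
    interpret stream_space "main_prog k" y U K n b k
    proof
      fix st :: "nat state" assume st: "bounded U st"
      have "insert 0 (regs (main_prog k)) \<subseteq> all_regs (k + 3)"
        using regs_main_prog[of k] rg_all_regs[of 0 0 "k + 3"] by (simp add: rg_0)
      then have "card (insert 0 (regs (main_prog k))) \<le> 18 * (k + 3)"
        by (rule order_trans[OF card_mono[OF card_all_regs(1)] card_all_regs(2)])
      then have "card (insert 0 (regs (main_prog k))) * bits U \<le> 18 * (k + 3) * bits U"
        by (rule mult_le_mono1)
      moreover have "card (chrs (main_prog k)) \<le> 2"
        using card_mono[OF _ chrs_main_prog[of k]] by simp
      ultimately show "mem (main_prog k) st + 20 * bits U \<le> K"
        using mem_le[OF st, of "main_prog k"] unfolding K_def add_mult_distrib by linarith
    next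
      show "1 < U" "(n + 2) ^ (2 * b + 6) \<le> U"
        using U by (simp_all add: U_def)
    qed (use len k(1) b in \<open>simp_all add: b_least\<close>)
    have "bounded U (initial_state n s)"
      using U by (auto simp: bounded_def initial_state_def)
    with main_prog_ok len obtain st m where
        run: "run (main_prog k) y (main_prog k) (initial_state n s) st m" "m \<le> K"
        "ed s y \<le> reg st 0" "reg st 0 \<le> 2 ^ (k + 2) * ed s y"
      unfolding ok_def by blast
    have "real (reg st 0) \<le> 2 ^ (k + 2) * real (ed s y)"
      using of_nat_mono[OF run(4), where 'a = real] by simp
    also have "(2 :: real) ^ (k + 2) \<le> 8 * 2 powr (1 / \<delta>)"
    proof -
      have "(2 :: real) ^ (k + 2) = 2 powr (real k + 2)"
        by (simp add: powr_add powr_realpow)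
      also have "\<dots> \<le> 2 powr (1 / \<delta> + 3)"
        using k by (intro powr_mono) auto
      also have "\<dots> = 8 * 2 powr (1 / \<delta>)"
        by (simp add: powr_add)
      finally show ?thesis .
    qed
    finally have D: "real (reg st 0) \<le> 8 * 2 powr (1 / \<delta>) * real (ed s y)"
      by (simp add: mult_right_mono)
    have "real m \<le> 6392 * (real n powr \<delta> / \<delta>) * log 2 (real n)" if n: "2 \<le> n"
    proof -
      have "K \<le> 94 * k * bits U"
      proof -
        have "(18 * (k + 3) + 20) * bits U \<le> 92 * k * bits U"
          using k by (intro mult_le_mono1) simp
        moreover have "1 * 1 \<le> k * bits U"
          using k bits_ge_1 by (intro mult_le_mono) auto
        ultimately show ?thesis
          unfolding K_def mult.assoc by linarith
      qed
      then have "real m \<le> real (94 * k * bits U)"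
        using run(2) by linarith
      also have "\<dots> = 94 * real k * real (bits U)"
        by simp
      also have "\<dots> \<le> 94 * real k * (17 * real b * log 2 (real n))"
        unfolding U_def using bits_power_le[OF n b(1)] by (intro mult_left_mono) auto
      also have "\<dots> = 1598 * (real k * real b) * log 2 (real n)"
        by simp
      \<comment> \<open>The constant 1598 is \<open>94 * 17\<close>. The factor 4 comes from a 2 in
        \<open>least_root_le\<close> and a 2 in \<open>levels_times_root_le\<close>, giving 6392 in
        total.\<close>
      also have "\<dots> \<le> 1598 * (4 * (real n powr \<delta> / \<delta>)) * log 2 (real n)"
      proof (intro mult_right_mono mult_left_mono)
        have "real k * real b \<le> real k * (2 * real n powr (1 / real k))"
          using least_root_le[OF k(1) n b_least] by (intro mult_left_mono) auto
        also have "\<dots> \<le> 4 * (real n powr \<delta> / \<delta>)"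
          using levels_times_root_le[OF \<delta> n k_def] by simp
        finally show "real k * real b \<le> 4 * (real n powr \<delta> / \<delta>)" .
      qed (use n in auto)
      finally show ?thesis by simp
    qed
    then show "\<exists>D m. computes (main_prog k) y s D m \<and> ed s y \<le> D \<and>
        real D \<le> 8 * 2 powr (1 / \<delta>) * real (ed s y) \<and>
        (2 \<le> n \<longrightarrow> real m \<le> 6392 * (real n powr \<delta> / \<delta>) * log 2 (real n) ^ 1)"
      using run D len unfolding computes_def
      by (intro exI[of _ "reg st 0"] exI[of _ m]) auto
  qed
qed

end
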